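(* Let $X$ be a standard Borel space with a Borel probability measure $\mu$. Let $Y$ be a Polish space. Let $p \colon Y \to X$ be a Borel map with $\mu(p(Y))=1$ and such that the set $p^{-1}(x)$ is compact for $\mu$-almost all $x\in X$. Let $\Gamma$ be a left amenable semigroup. Consider actions of $\Gamma$ on $Y$ and on $X$ such that: \begin{itemize} \item $\Gamma$ acts on $Y$ by continuous maps, i.e. for all $\gamma \in \Gamma$ the map $S_\gamma \colon Y \to Y$, $S_\gamma(y)=\gamma y$, is continuous; \item $\mu$ is $\Gamma$-invariant, i.e. for all $\gamma \in \Gamma$ the map $T_\gamma \colon X \to X$, $T_\gamma(x)=\gamma x$, is $\mu$-measurable and preserves $\mu$; \item the actions of $\Gamma$ on $Y$ and $X$ commute with $p$, i.e. $p \circ S_\gamma = T_\gamma \circ p$ for all $\gamma \in \Gamma$. \end{itemize} Then there exists a $\Gamma$-invariant Borel probability measure $\nu$ on $Y$ (i.e. $(S_\gamma)_*(\nu)=\nu$ for all $\gamma\in\Gamma$) such that $p_*(\nu)=\mu$.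
   Context: A Polish space is a separable, completely metrizable topological space. A standard Borel space is an uncountable set $X$ with a $\sigma$-algebra $\Sigma$ of subsets of $X$ (its Borel sets) such that there exists a Polish topology on $X$ whose Borel $\sigma$-algebra is $\Sigma$. A (discrete) semigroup $\Gamma$ is left amenable if there exists a left invariant mean for $\Gamma$, i.e. a positive linear functional $m$ on the space $\ell^\infty(\Gamma)$ of bounded real functions on $\Gamma$ with $m(1)=1$ and $m(f_\gamma)=m(f)$ for all $f\in\ell^\infty(\Gamma)$ and $\gamma\in\Gamma$, where $f_\gamma(\delta)=f(\gamma\delta)$. An action of $\Gamma$ on a set $Z$ is a map $\Gamma\times Z\to Z$, $(\gamma,z)\mapsto\gamma z$, with $(\gamma\delta)z=\gamma(\delta z)$. A map $T\colon X\to X$ is $\mu$-measurable if preimages of Borel sets belong to the completion of the Borel $\sigma$-algebra with respect to $\mu$; it preserves $\mu$ if $\mu(T^{-1}(A))=\mu(A)$ for all Borel $A\subset X$, where $\mu$ also denotes the completed measure. For a map $f$ and a measure $\sigma$, $f_*(\sigma)$ denotes the push-forward measure, $f_*(\sigma)(A)=\sigma(f^{-1}(A))$. The set $p(Y)$ is analytic, hence $\mu$-measurable, and $\mu(p(Y))$ is understood with respect to the completion of $\mu$. *)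

theory Defs
  imports "HOL-Probability.Probability"
begin

definition polish_topology :: "'a topology \<Rightarrow> bool" where
  "polish_topology Y \<longleftrightarrow> separable_space Y \<and> completely_metrizable_space Y"

definition borel_of :: "'a topology \<Rightarrow> 'a measure" where
  "borel_of Y = sigma (topspace Y) {U. openin Y U}"

lemma space_borel_of [simp]: "space (borel_of Y) = topspace Y"
  unfolding borel_of_def by (rule space_measure_of) (auto dest: openin_subset)

lemma sets_borel_of: "sets (borel_of Y) = sigma_sets (topspace Y) {U. openin Y U}"
  unfolding borel_of_def by (rule sets_measure_of) (auto dest: openin_subset)

(* Only the carrier and the sigma-algebra of M matter here, not its measure. Equality of
   the sigma-algebras forces topspace \<tau> = space M. Countable spaces are excluded. *)
definition standard_borel :: "'a measure \<Rightarrow> bool" where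
  "standard_borel M \<longleftrightarrow>
     uncountable (space M) \<and> (\<exists>\<tau>. polish_topology \<tau> \<and> sets M = sets (borel_of \<tau>))"

(* The conditions constrain m only on bounded functions; its other values are irrelevant. *)
definition left_invariant_mean :: "(('g::semigroup_mult \<Rightarrow> real) \<Rightarrow> real) \<Rightarrow> bool" where
  "left_invariant_mean m \<longleftrightarrow>
     (\<forall>f h. bounded (range f) \<longrightarrow> bounded (range h) \<longrightarrow> m (\<lambda>x. f x + h x) = m f + m h) \<and>
     (\<forall>c f. bounded (range f) \<longrightarrow> m (\<lambda>x. c * f x) = c * m f) \<and>
     (\<forall>f. bounded (range f) \<longrightarrow> (\<forall>x. 0 \<le> f x) \<longrightarrow> 0 \<le> m f) \<and>
     m (\<lambda>x. 1) = 1 \<and>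
     (\<forall>f g. bounded (range f) \<longrightarrow> m (\<lambda>x. f (g * x)) = m f)"

definition left_amenable :: "'g::semigroup_mult itself \<Rightarrow> bool" where
  "left_amenable (t :: 'g itself) \<longleftrightarrow> (\<exists>m :: ('g \<Rightarrow> real) \<Rightarrow> real. left_invariant_mean m)"

definition semigroup_action :: "'z set \<Rightarrow> ('g::semigroup_mult \<Rightarrow> 'z \<Rightarrow> 'z) \<Rightarrow> bool" where
  "semigroup_action Z act \<longleftrightarrow>
     (\<forall>g. \<forall>z\<in>Z. act g z \<in> Z) \<and>
     (\<forall>g h. \<forall>z\<in>Z. act (g * h) z = act g (act h z))"

(* Preimages of measurable sets are only required to lie in the completion of M. *)
definition preserves_completed :: "'a measure \<Rightarrow> ('a \<Rightarrow> 'a) \<Rightarrow> bool" where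
  "preserves_completed M T \<longleftrightarrow>
     T \<in> completion M \<rightarrow>\<^sub>M M \<and>
     (\<forall>A\<in>sets M. emeasure (completion M) (T -` A \<inter> space M) = emeasure M A)"

end

theory Submission
  imports Defs
begin

text \<open>The usual route takes a lift of \<open>\<mu>\<close> to \<open>Y\<close>, averages it over the semigroup and
  uses compactness of the set of all lifts. Here countable additivity is postponed to the very end,
  so that neither a measurable selection nor a topology on spaces of measures is needed.

  Finitely additive lifts are easy: a compactness argument in a cube of set functions gives a
  finitely additive probability on all subsets of \<open>Y\<close> whose image in \<open>X\<close> is the completion
  of \<open>\<mu>\<close> (\<open>finitely_additive_lift\<close>). Averaging it with an invariant mean yields a content
  \<open>l\<close> which still lifts \<open>\<mu>\<close> and is invariant: the preimage of a subset of \<open>Y\<close>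
  under \<open>S \<gamma>\<close> has the same content as the subset (\<open>amenable_average\<close>).

  Compactness of the fibres makes \<open>l\<close> countably additive where it matters. Call a Borel set
  fibre-compact if it meets almost every fibre in a compact set. If fibre-compact sets \<open>D n\<close>
  decrease to the empty set, then on almost every fibre they become empty at a finite stage. So
  the sets \<open>p ` D n\<close> decrease to a null set, and \<open>l (D n)\<close>, which is at most the measure of
  \<open>p ` D n\<close>, tends to zero (\<open>continuous_at_empty\<close>). The only descriptive set theory needed is
  that Borel images \<open>p ` D\<close> are measurable for the completion (\<open>borel_image_completion\<close>); it is
  proved by writing them as results of the Souslin operation on measurable sets and applying
  Choquet's capacity argument.

  The sets that \<open>l\<close> approximates by fibre-compact sets from inside and from outside form an
  algebra. It contains the preimages \<open>p -` B\<close> and, around each centre of a dense sequence, the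
  closed balls of all but countably many radii, hence generates the Borel sets; it is carried into itself by the preimage under
  \<open>S \<gamma>\<close>. Since \<open>l\<close> is continuous at the empty set on this algebra, Caratheodory's theorem
  extends it to a measure \<open>\<nu>\<close>. Invariance of \<open>\<nu>\<close> and \<open>distr \<nu> \<mu> p = \<mu>\<close> are
  inherited from \<open>l\<close>.\<close>

section \<open>The Souslin operation and capacity\<close>

text \<open>A scheme indexed by sequences of naturals must, at each of its countably many stages,
  look at finitely many coordinates only. Allowing an arbitrary finite set of coordinates instead
  of an initial segment makes reindexing of sequences harmless: two infinite families of sequences
  can be coded into one without any bookkeeping about lengths.\<close>

definition determined_by :: "nat set \<Rightarrow> ((nat \<Rightarrow> nat) \<Rightarrow> 'b) \<Rightarrow> bool" where
  "determined_by I f \<longleftrightarrow> (\<forall>s t. (\<forall>i\<in>I. s i = t i) \<longrightarrow> f s = f t)"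

definition fin_dep :: "((nat \<Rightarrow> nat) \<Rightarrow> 'b) \<Rightarrow> bool" where
  "fin_dep f \<longleftrightarrow> (\<exists>I. finite I \<and> determined_by I f)"

lemma determined_byD: "determined_by I f \<Longrightarrow> (\<And>i. i \<in> I \<Longrightarrow> s i = t i) \<Longrightarrow> f s = f t"
  unfolding determined_by_def by simp

lemma fin_depI:
  assumes "finite I" "\<And>s t. (\<And>i. i \<in> I \<Longrightarrow> s i = t i) \<Longrightarrow> f s = f t"
  shows "fin_dep f"
  unfolding fin_dep_def determined_by_def
proof (rule exI[of _ I], intro conjI allI impI)
  fix s t :: "nat \<Rightarrow> nat" assume "\<forall>i\<in>I. s i = t i"
  then show "f s = f t" by (intro assms(2)) simp
qed fact

lemma fin_depE:
  assumes "fin_dep f"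
  obtains I where "finite I" "determined_by I f"
  using assms unfolding fin_dep_def by blast

lemma fin_dep_const: "fin_dep (\<lambda>_. c)"
  by (rule fin_depI[of "{}"]) simp_all

lemma fin_dep_coord: "fin_dep (\<lambda>s. s i)"
  by (rule fin_depI[of "{i}"]) simp_all

lemma fin_dep_comp2:
  assumes "fin_dep f" "fin_dep g"
  shows "fin_dep (\<lambda>s. h (f s) (g s))"
proof -
  obtain I where I: "finite I" "determined_by I f"
    using fin_depE[OF assms(1)] by blast
  obtain J where J: "finite J" "determined_by J g"
    using fin_depE[OF assms(2)] by blast
  show ?thesis
  proof (rule fin_depI)
    fix s t :: "nat \<Rightarrow> nat" assume *: "\<And>i. i \<in> I \<union> J \<Longrightarrow> s i = t i"
    have "f s = f t" by (rule determined_byD[OF I(2)]) (simp add: *)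
    moreover have "g s = g t" by (rule determined_byD[OF J(2)]) (simp add: *)
    ultimately show "h (f s) (g s) = h (f t) (g t)" by (simp only:)
  qed (use I J in simp)
qed

lemma fin_dep_comp: "fin_dep f \<Longrightarrow> fin_dep (\<lambda>s. h (f s))"
  by (rule fin_dep_comp2[of f f "\<lambda>a _. h a"])

lemma fin_dep_reindex:
  assumes "fin_dep f"
  shows "fin_dep (\<lambda>s. f (\<lambda>j. s (h j)))"
proof -
  obtain I where I: "finite I" "determined_by I f"
    using fin_depE[OF assms] by blast
  show ?thesis
  proof (rule fin_depI)
    fix s t :: "nat \<Rightarrow> nat" assume *: "\<And>i. i \<in> h ` I \<Longrightarrow> s i = t i"
    show "f (\<lambda>j. s (h j)) = f (\<lambda>j. t (h j))" by (rule determined_byD[OF I(2)]) (simp add: *)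
  qed (use I(1) in simp)
qed

lemma fin_dep_INT:
  fixes R :: "nat \<Rightarrow> (nat \<Rightarrow> nat) \<Rightarrow> 'z set"
  assumes "\<And>m. fin_dep (R m)"
  shows "fin_dep (\<lambda>s. \<Inter>m<n::nat. R m s)"
proof (induction n)
  case (Suc n)
  then show ?case
    using fin_dep_comp2[OF Suc assms[of n], of "(\<inter>)"]
    by (simp add: lessThan_Suc Int_commute)
qed (simp add: fin_dep_const)

text \<open>The two compactness facts behind the capacity argument: over a box of sequences a finitely
  determined quantity has finitely many values, and its level sets are closed in the product
  topology.\<close>

lemma fin_dep_finite_image:
  assumes "fin_dep f"
  shows "finite (f ` {s. \<forall>i. s i \<le> k i})"
proof -
  obtain I where I: "finite I" "determined_by I f"
    using fin_depE[OF assms] by blast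
  have "f ` {s. \<forall>i. s i \<le> k i} \<subseteq> f ` (\<Pi>\<^sub>E i\<in>I. {..k i})"
  proof (clarify)
    fix s assume s: "\<forall>i. s i \<le> k i"
    have "f s = f (restrict s I)" by (rule determined_byD[OF I(2)]) simp
    moreover have "restrict s I \<in> (\<Pi>\<^sub>E i\<in>I. {..k i})" using s by auto
    ultimately show "f s \<in> f ` (\<Pi>\<^sub>E i\<in>I. {..k i})" by blast
  qed
  moreover have "finite (\<Pi>\<^sub>E i\<in>I. {..k i})" using I(1) by (intro finite_PiE) auto
  ultimately show ?thesis by (meson finite_imageI finite_subset)
qed

lemma fin_dep_closed:
  assumes "fin_dep (f :: (nat \<Rightarrow> nat) \<Rightarrow> 'b)"
  shows "closed {s. f s \<in> B}"
proof -
  obtain I where I: "finite I" "determined_by I f"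
    using fin_depE[OF assms] by blast
  have "open {t. f t \<notin> B}"
  proof (subst open_subopen, clarify)
    fix s assume s: "f s \<notin> B"
    have "open {t. \<forall>i\<in>I. t (id i) \<in> {s i :: nat}}"
      by (rule product_topology_basis'[OF I(1)]) (rule discrete_topology_class.open_discrete)
    moreover have "{t. \<forall>i\<in>I. t (id i) \<in> {s i}} \<subseteq> {t. f t \<notin> B}"
    proof (clarify)
      fix t assume t: "\<forall>i\<in>I. t (id i) \<in> {s i}" "f t \<in> B"
      have "f t = f s" by (rule determined_byD[OF I(2)]) (use t(1) in simp)
      with s t(2) show False by simp
    qed
    ultimately show "\<exists>T. open T \<and> s \<in> T \<and> T \<subseteq> {t. f t \<notin> B}"
      by (intro exI[of _ "{t. \<forall>i\<in>I. t (id i) \<in> {s i}}"]) auto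
  qed
  then show ?thesis by (simp add: closed_def Compl_eq)
qed

lemma compactin_nest:
  fixes C :: "nat \<Rightarrow> 'a set"
  assumes "compactin X (C 0)" "\<And>n. closedin X (C n)" "\<And>n. C n \<noteq> {}" "decseq C"
  shows "(\<Inter>n. C n) \<noteq> {}"
proof (rule compact_space_imp_nest)
  show "compact_space (subtopology X (C 0))"
    using assms(1) by (simp add: compactin_subspace)
  show "closedin (subtopology X (C 0)) (C n)" for n
    using assms(2) decseqD[OF assms(4), of 0 n] by (simp add: closedin_subset_topspace)
qed (use assms in auto)

text \<open>The classical Souslin operation takes a set for each finite word. Here stage \<open>m\<close>
  of a scheme is a function of the whole sequence that reads finitely many coordinates, so that
  schemes can be reindexed and combined freely.\<close>

definition souslin_scheme :: "'z set set \<Rightarrow> (nat \<Rightarrow> (nat \<Rightarrow> nat) \<Rightarrow> 'z set) \<Rightarrow> bool" where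
  "souslin_scheme F R \<longleftrightarrow> (\<forall>m. fin_dep (R m)) \<and> (\<forall>m s. R m s \<in> F)"

definition souslin :: "'z set set \<Rightarrow> 'z set \<Rightarrow> bool" where
  "souslin F A \<longleftrightarrow> (\<exists>R. souslin_scheme F R \<and> A = (\<Union>s. \<Inter>m. R m s))"

lemma souslin_schemeD:
  assumes "souslin_scheme F R"
  shows "fin_dep (R m)" "R m s \<in> F"
  using assms unfolding souslin_scheme_def by blast+

lemma souslinI:
  assumes "\<And>m::nat. fin_dep (R m)" "\<And>m s. R m s \<in> F" "A = (\<Union>s. \<Inter>m. R m s)"
  shows "souslin F A"
  unfolding souslin_def souslin_scheme_def using assms by blast

lemma souslinE:
  assumes "souslin F A"
  obtains R where "souslin_scheme F R" "A = (\<Union>s. \<Inter>m. R m s)"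
  using assms unfolding souslin_def by blast

lemma souslin_seqE:
  fixes A :: "'i \<Rightarrow> 'z set"
  assumes "\<And>i. souslin F (A i)"
  obtains R where "\<forall>i. souslin_scheme F (R i)" "\<forall>i. A i = (\<Union>s. \<Inter>m. R i m s)"
proof -
  have "\<forall>i. \<exists>R. souslin_scheme F R \<and> A i = (\<Union>s. \<Inter>m. R m s)"
    using assms unfolding souslin_def by blast
  then obtain R where "\<forall>i. souslin_scheme F (R i) \<and> A i = (\<Union>s. \<Inter>m. R i m s)"
    by (rule exE[OF choice])
  then show thesis by (intro that[of R]) blast+
qed

lemma souslin_basic: "A \<in> F \<Longrightarrow> souslin F A"
  by (rule souslinI[of "\<lambda>_ _. A"]) (auto simp: fin_dep_const)

lemma souslin_subset:
  assumes "souslin F A" "\<And>B. B \<in> F \<Longrightarrow> B \<subseteq> Z"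
  shows "A \<subseteq> Z"
proof
  obtain R where R: "souslin_scheme F R" "A = (\<Union>s. \<Inter>m. R m s)"
    using souslinE[OF assms(1)] .
  fix z assume "z \<in> A"
  then obtain s where "z \<in> R 0 s" unfolding R(2) by (auto simp only: UN_iff INT_iff)
  then show "z \<in> Z" using assms(2)[OF souslin_schemeD(2)[OF R(1)]] by (rule rev_subsetD)
qed

text \<open>A point of the intersection has one witnessing sequence for each of the sets. The pairing
  function weaves them into a single sequence, and the stages of all schemes into a single list of
  stages.\<close>

lemma souslin_INT:
  assumes "\<And>i::nat. souslin F (A i)"
  shows "souslin F (\<Inter>i. A i)"
proof -
  obtain R where Rs: "\<forall>i. souslin_scheme F (R i)" and R3': "\<forall>i. A i = (\<Union>s. \<Inter>m. R i m s)"
    by (rule souslin_seqE[OF assms])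
  note R1 = souslin_schemeD(1)[OF Rs[rule_format]] and R2 = souslin_schemeD(2)[OF Rs[rule_format]]
    and R3 = R3'[rule_format]
  define Q where "Q n s = R (fst (prod_decode n)) (snd (prod_decode n))
      (\<lambda>j. s (prod_encode (fst (prod_decode n), j)))" for n s
  show ?thesis
  proof (rule souslinI[of Q])
    show "fin_dep (Q m)" for m
      unfolding Q_def[abs_def] using fin_dep_reindex[OF R1[of "fst (prod_decode m)" "snd (prod_decode m)"],
        of "\<lambda>j. prod_encode (fst (prod_decode m), j)"] .
    show "Q m s \<in> F" for m s unfolding Q_def by (rule R2)
    show "(\<Inter>i. A i) = (\<Union>s. \<Inter>m. Q m s)"
    proof (intro equalityI subsetI)
      fix z assume "z \<in> (\<Inter>i. A i)"
      then have "\<forall>i. \<exists>s. \<forall>m. z \<in> R i m s" by (simp add: R3)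
      then obtain t where t: "\<forall>i m. z \<in> R i m (t i)" by (rule exE[OF choice])
      define s where "s n = t (fst (prod_decode n)) (snd (prod_decode n))" for n
      have "z \<in> Q m s" for m unfolding Q_def s_def using t by simp
      then show "z \<in> (\<Union>s. \<Inter>m. Q m s)" by (intro UN_I[OF UNIV_I] INT_I)
    next
      fix z assume "z \<in> (\<Union>s. \<Inter>m. Q m s)"
      then obtain s where s: "\<forall>m. z \<in> Q m s" by (auto simp only: UN_iff INT_iff)
      have "z \<in> R i m (\<lambda>j. s (prod_encode (i, j)))" for i m
        using s[rule_format, of "prod_encode (i, m)"] by (simp add: Q_def)
      then show "z \<in> (\<Inter>i. A i)" unfolding R3 by (intro INT_I UN_I[OF UNIV_I])
    qed
  qed
qed

text \<open>Here the first coordinate of the sequence says which of the sets the point belongs to, and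
  the remaining coordinates form its witness for that set. The stages of all other schemes must be
  vacuous, which is why the family needs a largest member.\<close>

lemma souslin_UN:
  assumes "\<And>i::nat. souslin F (A i)" and Z: "Z \<in> F" "\<And>B. B \<in> F \<Longrightarrow> B \<subseteq> Z"
  shows "souslin F (\<Union>i. A i)"
proof -
  obtain R where Rs: "\<forall>i. souslin_scheme F (R i)" and R3': "\<forall>i. A i = (\<Union>s. \<Inter>m. R i m s)"
    by (rule souslin_seqE[OF assms(1)])
  note R1 = souslin_schemeD(1)[OF Rs[rule_format]] and R2 = souslin_schemeD(2)[OF Rs[rule_format]]
    and R3 = R3'[rule_format]
  define Q where "Q n s = (if s 0 = fst (prod_decode n)
      then R (fst (prod_decode n)) (snd (prod_decode n)) (\<lambda>j. s (Suc j)) else Z)" for n s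
  show ?thesis
  proof (rule souslinI[of Q])
    show "fin_dep (Q m)" for m
      unfolding Q_def[abs_def]
      using fin_dep_comp2[OF fin_dep_coord[of 0] fin_dep_reindex[OF R1[of "fst (prod_decode m)" "snd (prod_decode m)"], of Suc],
        of "\<lambda>a B. if a = fst (prod_decode m) then B else Z"] .
    show "Q m s \<in> F" for m s unfolding Q_def using R2 Z by simp
    show "(\<Union>i. A i) = (\<Union>s. \<Inter>m. Q m s)"
    proof (intro equalityI subsetI)
      fix z assume "z \<in> (\<Union>i. A i)"
      then obtain i s where s: "\<forall>m. z \<in> R i m s" unfolding R3 by (auto simp only: UN_iff INT_iff)
      then have "z \<in> R i 0 s" by simp
      then have "z \<in> Z" using Z(2)[OF R2[of i 0 s]] by (rule rev_subsetD)
      then have "z \<in> Q m (case_nat i s)" for m unfolding Q_def using s by auto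
      then show "z \<in> (\<Union>s. \<Inter>m. Q m s)" by (intro UN_I[OF UNIV_I] INT_I)
    next
      fix z assume "z \<in> (\<Union>s. \<Inter>m. Q m s)"
      then obtain s where s: "\<forall>m. z \<in> Q m s" by (auto simp only: UN_iff INT_iff)
      have "z \<in> R (s 0) m (\<lambda>j. s (Suc j))" for m
        using s[rule_format, of "prod_encode (s 0, m)"] by (simp add: Q_def)
      then show "z \<in> (\<Union>i. A i)" unfolding R3 by (intro UN_I[OF UNIV_I] INT_I)
    qed
  qed
qed

lemma souslin_Int:
  assumes "souslin F A" "souslin F B"
  shows "souslin F (A \<inter> B)"
proof -
  have "souslin F (\<Inter>i::nat. if i = 0 then A else B)"
    by (rule souslin_INT) (use assms in auto)
  moreover have "(\<Inter>i::nat. if i = 0 then A else B) = A \<inter> B" by (auto split: if_splits)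
  ultimately show ?thesis by simp
qed

lemma souslin_Un:
  assumes "souslin F A" "souslin F B" and Z: "Z \<in> F" "\<And>B. B \<in> F \<Longrightarrow> B \<subseteq> Z"
  shows "souslin F (A \<union> B)"
proof -
  have "souslin F (\<Union>i::nat. if i = 0 then A else B)"
    by (rule souslin_UN[OF _ Z]) (use assms in auto)
  moreover have "(\<Union>i::nat. if i = 0 then A else B) = A \<union> B" by (auto split: if_splits)
  ultimately show ?thesis by simp
qed

text \<open>Choquet's capacity argument. The outer measure is continuous along increasing sequences
  of arbitrary sets, so the coordinates of the witnesses can be bounded one after another while the
  outer measure of the remaining part stays above \<open>c\<close>. Once all coordinates are
  bounded, the witnesses range over a compact box, on which the infinitely many stages can be
  satisfied simultaneously as soon as every finite number of them can; the finite approximations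
  are measurable because they are finite unions.\<close>

lemma souslin_inner_approx:
  assumes "souslin (sets M) A" "c < outer_measure_of M A" and fin: "finite_measure M"
  shows "\<exists>B\<in>sets M. B \<subseteq> A \<and> c \<le> emeasure M B"
proof -
  interpret finite_measure M by fact
  obtain R where Rs: "souslin_scheme (sets M) R" and R3: "A = (\<Union>s. \<Inter>m. R m s)"
    using souslinE[OF assms(1)] by blast
  note R1 = souslin_schemeD(1)[OF Rs] and R2 = souslin_schemeD(2)[OF Rs]
  \<comment> \<open>The part of \<open>A\<close> that has a witness in a given set of sequences.\<close>
  define P where "P Q = (\<Union>s\<in>Q. \<Inter>m. R m s)" for Q
  have Psp: "P Q \<subseteq> space M" for Q
    unfolding P_def using R2 sets.sets_into_space by blast
  have "\<exists>Q. \<forall>n. c < outer_measure_of M (P (Q n)) \<and> (\<exists>k. Q (Suc n) = Q n \<inter> {s. s n \<le> k})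
      \<and> (n = 0 \<longrightarrow> Q n = UNIV)"
  proof -
    have "\<exists>Q. \<forall>n. (c < outer_measure_of M (P (Q n)) \<and> (n = 0 \<longrightarrow> Q n = UNIV)) \<and>
             (\<exists>k. Q (Suc n) = Q n \<inter> {s. s n \<le> k})"
    proof (rule dependent_nat_choice)
      show "\<exists>Q. c < outer_measure_of M (P Q) \<and> ((0::nat) = 0 \<longrightarrow> Q = UNIV)"
        using assms(2) R3 by (auto simp: P_def)
    next
      fix Q and n :: nat assume "c < outer_measure_of M (P Q) \<and> (n = 0 \<longrightarrow> Q = UNIV)"
      moreover have "(SUP k. outer_measure_of M (P (Q \<inter> {s. s n \<le> k}))) = outer_measure_of M (P Q)"
      proof (subst SUP_outer_measure_of_incseq)
        show "incseq (\<lambda>k. P (Q \<inter> {s. s n \<le> k}))"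
          unfolding incseq_def P_def by (intro allI impI UN_mono) auto
        show "outer_measure_of M (\<Union>k. P (Q \<inter> {s. s n \<le> k})) = outer_measure_of M (P Q)"
          unfolding P_def by (rule arg_cong[of _ _ "outer_measure_of M"]) auto
      qed (rule Psp)
      ultimately have "c < (SUP k. outer_measure_of M (P (Q \<inter> {s. s n \<le> k})))" by simp
      then obtain k where "c < outer_measure_of M (P (Q \<inter> {s. s n \<le> k}))"
        by (auto simp only: less_SUP_iff)
      then show "\<exists>Q'. (c < outer_measure_of M (P Q') \<and> (Suc n = 0 \<longrightarrow> Q' = UNIV)) \<and>
          (\<exists>k. Q' = Q \<inter> {s. s n \<le> k})" by blast
    qed
    then show ?thesis by blast
  qed
  then obtain Q where Q: "\<And>n. c < outer_measure_of M (P (Q n))"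
    "\<And>n. \<exists>k. Q (Suc n) = Q n \<inter> {s. s n \<le> k}" "Q 0 = UNIV" by blast
  then obtain k where k: "\<And>n. Q (Suc n) = Q n \<inter> {s. s n \<le> k n}" by metis
  have Qn: "Q n = {s. \<forall>i<n. s i \<le> k i}" for n
    by (induction n) (auto simp: Q(3) k less_Suc_eq)
  define K where "K = {s. \<forall>i. s i \<le> k i}"
  define G where "G n s = (\<Inter>m<n. R m s) \<inter> space M" for n s
  define B where "B n = (\<Union>s\<in>K. G n s)" for n
  have G_dep: "fin_dep (G n)" for n
    unfolding G_def[abs_def] by (rule fin_dep_comp) (rule fin_dep_INT, rule R1)
  have Gm: "G n s \<in> sets M" for n s
  proof (cases "n = 0")
    case False
    then have "(\<Inter>m<n. R m s) \<in> sets M" by (intro sets.finite_INT) (auto simp: R2)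
    then show ?thesis unfolding G_def by auto
  qed (simp add: G_def)
  have Bm: "B n \<in> sets M" for n
  proof -
    have "finite (G n ` K)" unfolding K_def by (rule fin_dep_finite_image[OF G_dep])
    then have "\<Union>(G n ` K) \<in> sets M" using Gm by (intro sets.finite_Union) auto
    then show ?thesis by (simp add: B_def)
  qed
  \<comment> \<open>Stages below \<open>n\<close> read finitely many coordinates, so bounding enough coordinates of a
    witness is as good as bounding all of them.\<close>
  have PB: "\<exists>j. P (Q j) \<subseteq> B n" for n
  proof -
    obtain I where I: "finite I" "determined_by I (G n)"
      using fin_depE[OF G_dep] by blast
    obtain j where j: "I \<subseteq> {..<j}" using I(1) finite_nat_bounded by blast
    have "P (Q j) \<subseteq> B n"
    proof
      fix x assume x: "x \<in> P (Q j)"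
      then obtain s where s: "\<And>i. i < j \<Longrightarrow> s i \<le> k i" "\<And>m. x \<in> R m s"
        unfolding P_def Qn by blast
      have "x \<in> G n s" using s(2) Psp x unfolding G_def by blast
      also have "G n s = G n (\<lambda>i. min (s i) (k i))"
        by (rule determined_byD[OF I(2)]) (use s(1) j in \<open>auto simp: min_absorb1\<close>)
      finally show "x \<in> B n" unfolding B_def K_def
        by (intro UN_I[of "\<lambda>i. min (s i) (k i)"]) auto
    qed
    then show ?thesis by blast
  qed
  have Bc: "c \<le> emeasure M (B n)" for n
  proof -
    obtain j where "P (Q j) \<subseteq> B n" using PB by blast
    from outer_measure_of_mono[OF this, of M] Q(1)[of j] Bm[of n] show ?thesis by simp
  qed
  have "decseq B"
    unfolding decseq_def B_def G_def by (intro allI impI UN_mono Int_mono INT_anti_mono) auto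
  then have "emeasure M (\<Inter>n. B n) = (INF n. emeasure M (B n))"
    using Bm by (intro INF_emeasure_decseq[symmetric]) auto
  also have "c \<le> \<dots>" using Bc by (intro INF_greatest) auto
  finally have 1: "c \<le> emeasure M (\<Inter>n. B n)" .
  have Kc: "compactin euclidean K"
  proof -
    have "K = PiE UNIV (\<lambda>i. {..k i})" unfolding K_def by auto
    then show ?thesis
      using compactin_PiE[of "\<lambda>_. euclidean :: nat topology" UNIV "\<lambda>i. {..k i}"]
      by (auto simp: euclidean_product_topology finite_imp_compact)
  qed
  have Kcl: "closed K"
  proof -
    have "K = (\<Inter>i. {s. s i \<in> {..k i}})" unfolding K_def by auto
    then show ?thesis by (simp only:) (intro closed_INT ballI fin_dep_closed fin_dep_coord)
  qed
  have "(\<Inter>n. B n) \<subseteq> A"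
  proof
    fix x assume x: "x \<in> (\<Inter>n. B n)"
    define L where "L n = K \<inter> {s. G n s \<in> {S. x \<in> S}}" for n
    have "(\<Inter>n. L n) \<noteq> {}"
    proof (rule compactin_nest)
      have L: "closed (L n)" for n
        unfolding L_def by (intro closed_Int Kcl fin_dep_closed G_dep)
      then show "closedin euclidean (L n)" for n by (simp add: closed_closedin[symmetric])
      have "L 0 = K \<inter> L 0" unfolding L_def by blast
      then show "compactin euclidean (L 0)" using compact_Int_closed[OF _ L[of 0], of K] Kc by simp
      show "L n \<noteq> {}" for n using x unfolding L_def B_def by blast
      show "decseq L" unfolding decseq_def L_def G_def by auto
    qed
    then obtain s where "\<And>n. x \<in> G n s" unfolding L_def by blast
    then have "x \<in> R m s" for m unfolding G_def using INT_iff IntD1 lessI lessThan_iff by metis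
    then show "x \<in> A" unfolding R3 by (intro UN_I[OF UNIV_I] INT_I)
  qed
  with 1 Bm show ?thesis by (intro bexI[of _ "\<Inter>n. B n"]) auto
qed

lemma souslin_sets_completion:
  assumes "finite_measure M" "souslin (sets M) A"
  shows "A \<in> sets (completion M)"
proof -
  interpret finite_measure M by fact
  have "A \<subseteq> space M"
    by (rule souslin_subset[OF assms(2) sets.sets_into_space])
  from outer_measure_of_attain[OF this]
  obtain E where E: "E \<in> sets M" "A \<subseteq> E" "outer_measure_of M A = emeasure M E" by auto
  show ?thesis
  proof (cases "emeasure M E = 0")
    case True
    have "E \<in> null_sets (completion M)"
      using null_sets_completionI[OF null_setsI[OF True E(1)]] .
    with E(2) show ?thesis by (rule completion.complete)
  next
    case False
    have ex: "\<exists>B\<in>sets M. B \<subseteq> A \<and> emeasure M E \<le> emeasure M B + ennreal (1 / real (Suc n))" for n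
    proof -
      let ?e = "ennreal (1 / real (Suc n))"
      have "emeasure M E - ?e < emeasure M E"
        by (rule ennreal_between) (use False in \<open>simp_all add: emeasure_eq_measure zero_less_iff_neq_zero\<close>)
      then have "emeasure M E - ?e < outer_measure_of M A" using E(3) by simp
      then obtain B where "B \<in> sets M" "B \<subseteq> A" "emeasure M E - ?e \<le> emeasure M B"
        using souslin_inner_approx[OF assms(2) _ assms(1)] by blast
      then show ?thesis
        by (intro bexI[of _ B]) (simp_all add: ennreal_minus_le_iff add.commute)
    qed
    then obtain B where B: "\<And>n. B n \<in> sets M" "\<And>n. B n \<subseteq> A"
      "\<And>n. emeasure M E \<le> emeasure M (B n) + ennreal (1 / real (Suc n))"
      using choice[of "\<lambda>n B. B \<in> sets M \<and> B \<subseteq> A \<and> emeasure M E \<le> emeasure M B + ennreal (1 / real (Suc n))"]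
      by blast
    have "emeasure M E \<le> emeasure M (\<Union>n. B n)"
    proof (rule ennreal_le_epsilon)
      fix e :: real assume "0 < e"
      then obtain n where n: "1 / real (Suc n) < e" using nat_approx_posE by blast
      have "emeasure M E \<le> emeasure M (B n) + ennreal (1 / real (Suc n))" by (rule B)
      also have "\<dots> \<le> emeasure M (\<Union>n. B n) + ennreal e"
        using B(1) n by (intro add_mono emeasure_mono ennreal_leI) auto
      finally show "emeasure M E \<le> emeasure M (\<Union>n. B n) + ennreal e" .
    qed
    moreover have "emeasure M (\<Union>n. B n) \<le> emeasure M E"
      using B(2) E(1,2) by (intro emeasure_mono) blast+
    ultimately have "emeasure M (\<Union>n. B n) = emeasure M E" by simp
    then have "emeasure (completion M) (\<Union>n. B n) = emeasure (completion M) E"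
      using B(1) E(1) by simp
    moreover have "(\<Union>n. B n) \<subseteq> A" using B(2) by blast
    moreover have "(\<Union>n. B n) \<in> sets (completion M)" "E \<in> sets (completion M)"
      using B(1) E(1) by auto
    moreover have "emeasure (completion M) (\<Union>n. B n) < \<infinity>"
      using B(1) by (simp add: emeasure_eq_measure sets.countable_UN)
    ultimately show ?thesis
      using E(2) completion.complete_sets_sandwich by metis
  qed
qed

section \<open>Measurability of Borel images\<close>

lemma polish_metricE:
  assumes "polish_topology Y" "topspace Y \<noteq> {}"
  obtains d a where "Metric_space (topspace Y) d" "Metric_space.mcomplete (topspace Y) d"
    "Metric_space.mtopology (topspace Y) d = Y"
    "\<forall>j::nat. a j \<in> topspace Y" "\<forall>y\<in>topspace Y. \<forall>e>0. \<exists>j. d (a j) y < e"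
proof -
  obtain M d where M: "Metric_space M d" "Metric_space.mcomplete M d"
    and Y: "Y = Metric_space.mtopology M d"
    using assms(1) unfolding polish_topology_def completely_metrizable_space_def by blast
  interpret Metric_space M d by fact
  have sp: "topspace Y = M" by (simp add: Y)
  obtain C where C: "countable C" "C \<subseteq> topspace Y" "Y closure_of C = topspace Y"
    using assms(1) unfolding polish_topology_def separable_space_def by blast
  have "C \<noteq> {}"
  proof
    assume "C = {}"
    with C(3) have "topspace Y = {}" by (simp only: closure_of_empty)
    with assms(2) show False by contradiction
  qed
  show thesis
  proof (rule that[of d "from_nat_into C"])
    show "\<forall>j. from_nat_into C j \<in> topspace Y"
      using C(2) \<open>C \<noteq> {}\<close> from_nat_into[of C] by (intro allI subsetD[OF C(2)]) simp
    show "\<forall>y\<in>topspace Y. \<forall>e>0. \<exists>j. d (from_nat_into C j) y < e"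
    proof (intro ballI allI impI)
      fix y and e :: real assume y: "y \<in> topspace Y" and e: "0 < e"
      then have "y \<in> mtopology closure_of C" using C(3) Y by simp
      then obtain c where c: "c \<in> C" "c \<in> mball y e"
        using e unfolding metric_closure_of by auto
      have "d c y < e" using c(2) by (simp add: commute)
      then have "d (from_nat_into C (to_nat_on C c)) y < e"
        using from_nat_into_to_nat_on[OF C(1) c(1)] by simp
      then show "\<exists>j. d (from_nat_into C j) y < e" by (rule exI)
    qed
  qed (use M Y sp in simp_all)
qed

lemma standard_borel_separating:
  assumes "standard_borel M"
  obtains B :: "nat \<Rightarrow> 'x set" where "\<forall>i. B i \<in> sets M"
    "\<forall>x\<in>space M. \<forall>y\<in>space M. (\<forall>i. x \<in> B i \<longleftrightarrow> y \<in> B i) \<longrightarrow> x = y"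
proof -
  obtain \<tau> where t: "polish_topology \<tau>" "sets M = sets (borel_of \<tau>)" and unc: "uncountable (space M)"
    using assms unfolding standard_borel_def by blast
  have sp: "space M = topspace \<tau>" using sets_eq_imp_space_eq[OF t(2)] by simp
  with unc have ne: "topspace \<tau> \<noteq> {}" by auto
  obtain d a where d: "Metric_space (topspace \<tau>) d" "Metric_space.mcomplete (topspace \<tau>) d"
    and mt: "Metric_space.mtopology (topspace \<tau>) d = \<tau>"
    and a: "\<forall>j::nat. a j \<in> topspace \<tau>" and dense: "\<forall>y\<in>topspace \<tau>. \<forall>e>0. \<exists>j. d (a j) y < e"
    by (rule polish_metricE[OF t(1) ne])
  interpret Metric_space "topspace \<tau>" d by (fact d(1))
  define B where "B i = mball (a (fst (prod_decode i))) (1 / real (Suc (snd (prod_decode i))))" for i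
  show thesis
  proof (rule that[of B])
    show "\<forall>i. B i \<in> sets M"
      unfolding t(2) sets_borel_of B_def
      by (intro allI sigma_sets.Basic) (use openin_mball mt in simp)
  next
    show "\<forall>x\<in>space M. \<forall>y\<in>space M. (\<forall>i. x \<in> B i \<longleftrightarrow> y \<in> B i) \<longrightarrow> x = y"
    proof (intro ballI impI)
      fix x y assume x: "x \<in> space M" and y: "y \<in> space M" and eq: "\<forall>i. x \<in> B i \<longleftrightarrow> y \<in> B i"
      show "x = y"
      proof (rule ccontr)
        assume "x \<noteq> y"
        then have "0 < d x y / 2" using x y sp by simp
        then obtain n where n: "1 / real (Suc n) < d x y / 2" using nat_approx_posE by blast
        obtain j where j: "d (a j) x < 1 / real (Suc n)"
          using dense[rule_format, of x "1 / real (Suc n)"] x sp by auto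
        have "x \<in> B (prod_encode (j, n))" using j a x sp by (simp add: B_def)
        then have "y \<in> B (prod_encode (j, n))" using eq by simp
        then have "d (a j) y < 1 / real (Suc n)" by (simp add: B_def)
        then have "d x y < 2 * (1 / real (Suc n))"
          using j triangle[of x "a j" y] x y sp a[rule_format, of j] by (simp add: commute)
        with n show False by simp
      qed
    qed
  qed
qed

text \<open>In a metrizable space open sets are countable unions of closed ones, so the sets that are
  Souslin over the closed sets together with their complement form a sigma-algebra containing the
  open sets.\<close>

lemma borel_of_souslin_closed:
  assumes "metrizable_space Y" "D \<in> sets (borel_of Y)"
  shows "souslin {C. closedin Y C} D \<and> souslin {C. closedin Y C} (topspace Y - D)"
proof -
  let ?F = "{C. closedin Y C}"
  have Z: "topspace Y \<in> ?F" "\<And>B. B \<in> ?F \<Longrightarrow> B \<subseteq> topspace Y" by (auto dest: closedin_subset)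
  have "D \<in> sigma_sets (topspace Y) {U. openin Y U}" using assms(2) by (simp add: sets_borel_of)
  then show ?thesis
  proof induction
    case (Basic U)
    then have "fsigma_in Y U" using open_imp_fsigma_in[OF assms(1)] by simp
    then obtain C where C: "\<forall>n::nat. closedin Y (C n)" "\<forall>n. C n \<subseteq> C (Suc n)" "\<Union>(range C) = U"
      unfolding fsigma_in_ascending by (elim exE conjE)
    have "souslin ?F (C n)" for n by (rule souslin_basic) (simp add: C(1))
    then have "souslin ?F (\<Union>n. C n)" by (rule souslin_UN[OF _ Z])
    moreover have "souslin ?F (topspace Y - U)" by (rule souslin_basic) (use Basic in auto)
    ultimately show ?case using C(3) by simp
  next
    case (Compl A)
    moreover have "A \<subseteq> topspace Y"
      by (rule sigma_sets_into_sp[OF _ Compl(1)]) (auto dest: openin_subset)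
    ultimately show ?case by (simp add: double_diff)
  next
    case (Union A)
    have "topspace Y - (\<Union>i. A i) = (\<Inter>i. topspace Y - A i)" by auto
    moreover have "souslin ?F (\<Union>i. A i)" by (rule souslin_UN[OF _ Z]) (use Union in simp)
    moreover have "souslin ?F (\<Inter>i. topspace Y - A i)" by (rule souslin_INT) (use Union in simp)
    ultimately show ?case by simp
  qed (simp_all add: souslin_basic)
qed

definition closed_rects :: "'y topology \<Rightarrow> 'x measure \<Rightarrow> ('y \<times> 'x) set set" where
  "closed_rects Y M = {C \<times> B |C B. closedin Y C \<and> B \<in> sets M}"

lemma souslin_closed_rect:
  assumes "souslin {C. closedin Y C} A" "B \<in> sets M"
  shows "souslin (closed_rects Y M) (A \<times> B)"
proof -
  obtain R where R: "souslin_scheme {C. closedin Y C} R" "A = (\<Union>s. \<Inter>m. R m s)"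
    using souslinE[OF assms(1)] .
  show ?thesis
  proof (rule souslinI[of "\<lambda>m s. R m s \<times> B"])
    show "fin_dep (\<lambda>s. R m s \<times> B)" for m
      using fin_dep_comp[OF souslin_schemeD(1)[OF R(1), of m], of "\<lambda>C. C \<times> B"] .
    show "R m s \<times> B \<in> closed_rects Y M" for m s
      using souslin_schemeD(2)[OF R(1), of m s] assms(2) by (auto simp: closed_rects_def)
    show "A \<times> B = (\<Union>s. \<Inter>m. R m s \<times> B)"
      unfolding R(2) by auto
  qed
qed

text \<open>A countable family separating points turns the equation \<open>x = p y\<close> into
  countably many conditions, each saying that \<open>x\<close> and \<open>p y\<close> lie on the
  same side of one set of the family.\<close>

lemma souslin_graph:
  assumes "metrizable_space Y" "standard_borel M" and p: "p \<in> borel_of Y \<rightarrow>\<^sub>M M"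
    and D: "D \<in> sets (borel_of Y)"
  shows "souslin (closed_rects Y M) {(y, x). y \<in> D \<and> x = p y}"
proof -
  let ?G = "closed_rects Y M"
  obtain B :: "nat \<Rightarrow> _ set" where B: "\<forall>i. B i \<in> sets M"
    "\<forall>x\<in>space M. \<forall>y\<in>space M. (\<forall>i. x \<in> B i \<longleftrightarrow> y \<in> B i) \<longrightarrow> x = y"
    by (rule standard_borel_separating[OF assms(2)])
  have Z: "topspace Y \<times> space M \<in> ?G" "\<And>R. R \<in> ?G \<Longrightarrow> R \<subseteq> topspace Y \<times> space M"
    unfolding closed_rects_def using closedin_subset sets.sets_into_space by fastforce+
  define E where "E i = p -` B i \<inter> topspace Y" for i
  have E: "E i \<in> sets (borel_of Y)" for i
    using measurable_sets[OF p B(1)[rule_format, of i]] by (simp add: E_def)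
  define W where "W i = E i \<times> B i \<union> (topspace Y - E i) \<times> (space M - B i)" for i
  have W: "souslin ?G (W i)" for i
    unfolding W_def using borel_of_souslin_closed[OF assms(1) E[of i]] B(1)
    by (intro souslin_Un[OF _ _ Z] souslin_closed_rect) auto
  have "souslin ?G (D \<times> space M \<inter> (\<Inter>i. W i))"
    using borel_of_souslin_closed[OF assms(1) D]
    by (intro souslin_Int souslin_INT W souslin_closed_rect) auto
  moreover have "D \<times> space M \<inter> (\<Inter>i. W i) = {(y, x). y \<in> D \<and> x = p y}" (is "?L = ?R")
  proof (intro equalityI subsetI)
    have DY: "D \<subseteq> topspace Y" using sets.sets_into_space[OF D] by simp
    fix z assume z: "z \<in> ?L"
    obtain y x where yx: "z = (y, x)" by (cases z)
    have y: "y \<in> D" "y \<in> topspace Y" "x \<in> space M" using z yx DY by auto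
    have py: "p y \<in> space M" using measurable_space[OF p] y by simp
    have "x = p y"
    proof (rule B(2)[rule_format, OF y(3) py])
      fix i
      have "(y, x) \<in> W i" using z yx by blast
      then show "x \<in> B i \<longleftrightarrow> p y \<in> B i" unfolding W_def E_def using y by auto
    qed
    then show "z \<in> ?R" using yx y by simp
  next
    have DY: "D \<subseteq> topspace Y" using sets.sets_into_space[OF D] by simp
    fix z assume z: "z \<in> ?R"
    then obtain y where yx: "z = (y, p y)" "y \<in> D" by auto
    have py: "p y \<in> space M" "y \<in> topspace Y" using measurable_space[OF p] DY yx by auto
    have "z \<in> W i" for i unfolding W_def E_def yx using py by auto
    then show "z \<in> ?L" using yx py by auto
  qed
  ultimately show ?thesis by simp
qed

text \<open>A point \<open>x\<close> is in the projection when some sequence puts \<open>x\<close> into all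
  measurable sides of the rectangles and the closed sides have a common point. Completeness reduces
  the second condition to nonempty finite intersections, provided that the closed sets shrink. To
  make them shrink, the odd coordinates of the sequence name small balls around the points of a
  dense sequence, while the even ones run the given scheme.\<close>

lemma souslin_projection:
  assumes "polish_topology Y" "souslin (closed_rects Y M) W"
  shows "souslin (sets M) (snd ` W)"
proof (cases "topspace Y = {}")
  case True
  have "W \<subseteq> {}"
    by (rule souslin_subset[OF assms(2)]) (use True closedin_subset in \<open>fastforce simp: closed_rects_def\<close>)
  then show ?thesis by (auto intro: souslin_basic)
next
  case False
  obtain d a where d: "Metric_space (topspace Y) d" and compl: "Metric_space.mcomplete (topspace Y) d"
    and mt: "Metric_space.mtopology (topspace Y) d = Y"
    and a: "\<forall>j::nat. a j \<in> topspace Y" "\<forall>y\<in>topspace Y. \<forall>e>0. \<exists>j. d (a j) y < e"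
    by (rule polish_metricE[OF assms(1) False])
  interpret Metric_space "topspace Y" d by fact
  obtain R where R: "souslin_scheme (closed_rects Y M) R" "W = (\<Union>s. \<Inter>m. R m s)"
    using souslinE[OF assms(2)] .
  have "\<forall>G. \<exists>CB. G \<in> closed_rects Y M \<longrightarrow> closedin Y (fst CB) \<and> snd CB \<in> sets M \<and> G = fst CB \<times> snd CB"
    unfolding closed_rects_def by auto
  then obtain cb where cb: "\<forall>G. G \<in> closed_rects Y M \<longrightarrow>
      closedin Y (fst (cb G)) \<and> snd (cb G) \<in> sets M \<and> G = fst (cb G) \<times> snd (cb G)"
    by (rule exE[OF choice])
  define c where "c m s = fst (cb (R m s))" for m s
  define b where "b m s = snd (cb (R m s))" for m s
  have c: "closedin Y (c m s)" and b: "b m s \<in> sets M" and Rcb: "R m s = c m s \<times> b m s" for m s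
    using cb[rule_format, OF souslin_schemeD(2)[OF R(1)], of m s] by (auto simp: c_def b_def)
  have c_dep: "fin_dep (c m)" for m
    unfolding c_def[abs_def] using fin_dep_comp[OF souslin_schemeD(1)[OF R(1), of m], of "\<lambda>G. fst (cb G)"] .
  have b_dep: "fin_dep (b m)" for m
    unfolding b_def[abs_def] using fin_dep_comp[OF souslin_schemeD(1)[OF R(1), of m], of "\<lambda>G. snd (cb G)"] .
  define ev where "ev s = (\<lambda>j. s (2 * j))" for s :: "nat \<Rightarrow> nat"
  define K where "K n j = mcball (a j) (1 / real (Suc n))" for n j
  define V where "V m s = topspace Y \<inter> ((\<Inter>i<m. c i (ev s)) \<inter> (\<Inter>n<m. K n (s (2 * n + 1))))" for m s
  have V_dep: "fin_dep (V m)" for m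
  proof -
    have 1: "fin_dep (\<lambda>s. \<Inter>i<m. c i (ev s))"
      unfolding ev_def using fin_dep_reindex[OF c_dep] by (rule fin_dep_INT)
    have 2: "fin_dep (\<lambda>s. \<Inter>n<m. K n (s (2 * n + 1)))"
      using fin_dep_comp[OF fin_dep_coord] by (rule fin_dep_INT)
    show ?thesis
      unfolding V_def[abs_def] using fin_dep_comp2[OF 1 2, of "\<lambda>A B. topspace Y \<inter> (A \<inter> B)"] .
  qed
  have Vcl: "closedin Y (V m s)" for m s
  proof -
    have K: "closedin Y (K n j)" for n j using closedin_mcball mt unfolding K_def by simp
    have *: "closedin Y (topspace Y \<inter> (\<Inter>i<m. A i))" if "\<And>i. closedin Y (A i)" for A
    proof (induction m)
      case (Suc m)
      have "topspace Y \<inter> (\<Inter>i<Suc m. A i) = (topspace Y \<inter> (\<Inter>i<m. A i)) \<inter> A m"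
        by (auto simp: lessThan_Suc)
      then show ?case using closedin_Int[OF Suc that[of m]] by simp
    qed simp
    have "V m s = (topspace Y \<inter> (\<Inter>i<m. c i (ev s))) \<inter> (topspace Y \<inter> (\<Inter>n<m. K n (s (2 * n + 1))))"
      unfolding V_def by blast
    then show ?thesis using closedin_Int[OF *[OF c] *[OF K]] by simp
  qed
  define Q where "Q m s = (if V m s = {} then {} else b m (ev s))" for m s
  show ?thesis
  proof (rule souslinI[of Q])
    show "fin_dep (Q m)" for m
      unfolding Q_def[abs_def] ev_def
      using fin_dep_comp2[OF V_dep[of m] fin_dep_reindex[OF b_dep[of m], of "\<lambda>j. 2 * j"],
        of "\<lambda>A B. if A = {} then {} else B"] .
    show "Q m s \<in> sets M" for m s unfolding Q_def using b by auto
    show "snd ` W = (\<Union>s. \<Inter>m. Q m s)"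
    proof (intro equalityI subsetI)
      fix x assume "x \<in> snd ` W"
      then obtain y where "(y, x) \<in> W" by auto
      then obtain t where "\<forall>m. (y, x) \<in> R m t" unfolding R(2) by (auto simp only: UN_iff INT_iff)
      then have t: "y \<in> c m t" "x \<in> b m t" for m using Rcb[of m t] by auto
      have y: "y \<in> topspace Y" using t(1) closedin_subset[OF c] by blast
      have "\<forall>n. \<exists>j. d (a j) y < 1 / real (Suc n)" using a(2) y by simp
      then obtain u where u: "\<forall>n. d (a (u n)) y < 1 / real (Suc n)" by (rule exE[OF choice])
      define s where "s i = (if even i then t (i div 2) else u (i div 2))" for i
      have evs: "ev s = t" by (auto simp: ev_def s_def)
      have "y \<in> V m s" for m
        unfolding V_def evs using t(1) y a(1) u by (auto simp: K_def s_def intro: less_imp_le)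
      then have "x \<in> Q m s" for m unfolding Q_def evs using t(2) by auto
      then show "x \<in> (\<Union>s. \<Inter>m. Q m s)" by (intro UN_I[OF UNIV_I] INT_I)
    next
      fix x assume "x \<in> (\<Union>s. \<Inter>m. Q m s)"
      then obtain s where s: "\<forall>m. x \<in> Q m s" by (auto simp only: UN_iff INT_iff)
      have ne: "V m s \<noteq> {}" and xb: "x \<in> b m (ev s)" for m
        using s[rule_format, of m] by (auto simp: Q_def split: if_splits)
      have "\<Inter>(range (\<lambda>m. V m s)) \<noteq> {}"
      proof (rule compl[unfolded mcomplete_nest, rule_format], intro conjI allI impI)
        show "closedin mtopology (V m s)" for m using Vcl mt by simp
        show "V m s \<noteq> {}" for m by (rule ne)
        show "decseq (\<lambda>m. V m s)" unfolding decseq_def V_def by fastforce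
        fix e :: real assume "0 < e"
        then obtain n where n: "1 / real (Suc n) < e" using nat_approx_posE by blast
        have "V (Suc n) s \<subseteq> K n (s (2 * n + 1))" unfolding V_def by blast
        also have "\<dots> \<subseteq> mcball (a (s (2 * n + 1))) e"
          unfolding K_def using n by (intro mcball_subset_concentric) simp
        finally show "\<exists>m z. V m s \<subseteq> mcball z e" by blast
      qed
      then obtain y where y: "\<And>m. y \<in> V m s" by blast
      have "y \<in> c m (ev s)" for m using y[of "Suc m"] unfolding V_def by blast
      then have "(y, x) \<in> R m (ev s)" for m using xb Rcb by blast
      then have "(y, x) \<in> W" unfolding R(2) by (intro UN_I[OF UNIV_I] INT_I)
      then show "x \<in> snd ` W" by force
    qed
  qed
qed

text \<open>The image is the projection of the graph of \<open>p\<close> over \<open>D\<close>, hence a result of the Souslin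
  operation on measurable sets, and these are measurable for the completion.\<close>

lemma borel_image_completion:
  assumes "standard_borel M" "finite_measure M" "polish_topology Y" "p \<in> borel_of Y \<rightarrow>\<^sub>M M"
    and "D \<in> sets (borel_of Y)"
  shows "p ` D \<in> sets (completion M)"
proof -
  have "metrizable_space Y"
    using assms(3) completely_metrizable_imp_metrizable_space by (auto simp: polish_topology_def)
  from souslin_projection[OF assms(3) souslin_graph[OF this assms(1,4,5)]]
  have "souslin (sets M) (snd ` {(y, x). y \<in> D \<and> x = p y})" .
  moreover have "snd ` {(y, x). y \<in> D \<and> x = p y} = p ` D" by force
  ultimately show ?thesis using souslin_sets_completion[OF assms(2)] by simp
qed

section \<open>Finitely additive lifts and their averages\<close>

definition fin_add_prob :: "'a set \<Rightarrow> ('a set \<Rightarrow> real) \<Rightarrow> bool" where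
  "fin_add_prob \<Omega> l \<longleftrightarrow> (\<forall>A. A \<subseteq> \<Omega> \<longrightarrow> 0 \<le> l A) \<and> l \<Omega> = 1 \<and>
     (\<forall>A B. A \<subseteq> \<Omega> \<longrightarrow> B \<subseteq> \<Omega> \<longrightarrow> A \<inter> B = {} \<longrightarrow> l (A \<union> B) = l A + l B)"

context
  fixes \<Omega> :: "'a set" and l :: "'a set \<Rightarrow> real"
  assumes l: "fin_add_prob \<Omega> l"
begin

lemma fin_add_prob_nonneg: "A \<subseteq> \<Omega> \<Longrightarrow> 0 \<le> l A"
  using l unfolding fin_add_prob_def by simp

lemma fin_add_prob_Un: "A \<subseteq> \<Omega> \<Longrightarrow> B \<subseteq> \<Omega> \<Longrightarrow> A \<inter> B = {} \<Longrightarrow> l (A \<union> B) = l A + l B"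
  using l unfolding fin_add_prob_def by simp

lemma fin_add_prob_space: "l \<Omega> = 1"
  using l unfolding fin_add_prob_def by simp

lemma fin_add_prob_empty: "l {} = 0"
  using fin_add_prob_Un[of "{}" "{}"] by simp

lemma fin_add_prob_Diff:
  assumes "A \<subseteq> B" "B \<subseteq> \<Omega>"
  shows "l (B - A) = l B - l A"
proof -
  have "l (A \<union> (B - A)) = l A + l (B - A)"
    by (rule fin_add_prob_Un) (use assms in auto)
  moreover have "A \<union> (B - A) = B" using assms by blast
  ultimately show ?thesis by simp
qed

lemma fin_add_prob_mono: "A \<subseteq> B \<Longrightarrow> B \<subseteq> \<Omega> \<Longrightarrow> l A \<le> l B"
  using fin_add_prob_Diff[of A B] fin_add_prob_nonneg[of "B - A"] by auto

lemma fin_add_prob_le_1: "A \<subseteq> \<Omega> \<Longrightarrow> l A \<le> 1"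
  using fin_add_prob_mono[of A \<Omega>] fin_add_prob_space by simp

lemma fin_add_prob_subadd:
  assumes "A \<subseteq> \<Omega>" "B \<subseteq> \<Omega>"
  shows "l (A \<union> B) \<le> l A + l B"
proof -
  have "l (A \<union> (B - A)) = l A + l (B - A)"
    by (rule fin_add_prob_Un) (use assms in auto)
  moreover have "l (B - A) \<le> l B" by (rule fin_add_prob_mono) (use assms in auto)
  ultimately show ?thesis by simp
qed

lemma fin_add_prob_subadd_UN:
  assumes "\<And>i. i \<le> n \<Longrightarrow> A i \<subseteq> \<Omega>"
  shows "l (\<Union>i\<le>n::nat. A i) \<le> (\<Sum>i\<le>n. l (A i))"
  using assms
proof (induction n)
  case (Suc n)
  have "l ((\<Union>i\<le>n. A i) \<union> A (Suc n)) \<le> l (\<Union>i\<le>n. A i) + l (A (Suc n))"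
  proof (rule fin_add_prob_subadd)
    show "(\<Union>i\<le>n. A i) \<subseteq> \<Omega>" by (intro UN_least Suc.prems) simp
  qed (use Suc.prems in simp)
  with Suc show ?case by (simp add: atMost_Suc Un_commute)
qed simp

end

text \<open>Finitely many measurable sets cut the base into finitely many atoms. Choose one point of
  the total space above each atom that the projection meets and give it the mass of that atom: this
  finite sum of point masses lifts the measure as far as the given sets can see.\<close>

lemma (in prob_space) discrete_lift:
  assumes p: "p \<in> \<Omega> \<rightarrow> space M" and ae: "AE x in M. x \<in> p ` \<Omega>"
    and G: "finite G" "G \<subseteq> sets M"
  shows "\<exists>l. fin_add_prob \<Omega> l \<and> (\<forall>B\<in>G. l (p -` B \<inter> \<Omega>) = measure M B)"
proof -
  have "\<Omega> \<noteq> {}" using ae by auto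
  then obtain y0 where y0: "y0 \<in> \<Omega>" by blast
  \<comment> \<open>The atom of a point is recorded as the set of those members of \<open>G\<close> that contain it.\<close>
  define c where "c x = {B \<in> G. x \<in> B}" for x
  have "\<forall>J. \<exists>y. y \<in> \<Omega> \<and> (J \<in> (\<lambda>y. c (p y)) ` \<Omega> \<longrightarrow> c (p y) = J)"
  proof
    fix J
    show "\<exists>y. y \<in> \<Omega> \<and> (J \<in> (\<lambda>y. c (p y)) ` \<Omega> \<longrightarrow> c (p y) = J)"
      using y0 by (cases "J \<in> (\<lambda>y. c (p y)) ` \<Omega>") auto
  qed
  then obtain sel where sel: "\<forall>J. sel J \<in> \<Omega> \<and> (J \<in> (\<lambda>y. c (p y)) ` \<Omega> \<longrightarrow> c (p (sel J)) = J)"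
    by (rule exE[OF choice])
  define N where "N A = {x \<in> space M. sel (c x) \<in> A}" for A
  have N: "N A \<in> events" for A
  proof -
    have "N A = (\<Union>J\<in>{J \<in> Pow G. sel J \<in> A}. {x \<in> space M. \<forall>B\<in>G. x \<in> B \<longleftrightarrow> B \<in> J})"
      unfolding N_def
    proof (intro equalityI subsetI)
      fix x assume "x \<in> {x \<in> space M. sel (c x) \<in> A}"
      then show "x \<in> (\<Union>J\<in>{J \<in> Pow G. sel J \<in> A}. {x \<in> space M. \<forall>B\<in>G. x \<in> B \<longleftrightarrow> B \<in> J})"
        by (intro UN_I[of "c x"]) (auto simp: c_def)
    next
      fix x assume "x \<in> (\<Union>J\<in>{J \<in> Pow G. sel J \<in> A}. {x \<in> space M. \<forall>B\<in>G. x \<in> B \<longleftrightarrow> B \<in> J})"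
      then obtain J where J: "J \<subseteq> G" "sel J \<in> A" "x \<in> space M" "\<forall>B\<in>G. x \<in> B \<longleftrightarrow> B \<in> J" by auto
      then have "c x = J" unfolding c_def by blast
      with J show "x \<in> {x \<in> space M. sel (c x) \<in> A}" by simp
    qed
    also have "\<dots> \<in> events"
    proof (intro sets.finite_UN)
      show "finite {J \<in> Pow G. sel J \<in> A}" using G(1) by simp
      fix J
      have "{x \<in> space M. x \<in> B \<longleftrightarrow> B \<in> J} \<in> events" if "B \<in> G" for B
      proof -
        have "B \<in> events" using G(2) that by blast
        moreover have "{x \<in> space M. x \<in> B \<longleftrightarrow> B \<in> J} = (if B \<in> J then B else space M - B)"
          using sets.sets_into_space[OF \<open>B \<in> events\<close>] by auto
        ultimately show ?thesis by auto
      qed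
      then show "{x \<in> space M. \<forall>B\<in>G. x \<in> B \<longleftrightarrow> B \<in> J} \<in> events"
        by (intro sets.sets_Collect_finite_All' sets.sets_Collect_finite_All G) 
    qed
    finally show ?thesis .
  qed
  define l where "l A = prob (N A)" for A
  have "fin_add_prob \<Omega> l"
    unfolding fin_add_prob_def
  proof (intro conjI allI impI)
    have "N \<Omega> = space M" unfolding N_def using sel by auto
    then show "l \<Omega> = 1" unfolding l_def by (simp add: prob_space)
    fix A B :: "'b set" assume "A \<inter> B = {}"
    moreover have "N (A \<union> B) = N A \<union> N B" unfolding N_def by auto
    moreover have "N A \<inter> N B = {}" using \<open>A \<inter> B = {}\<close> unfolding N_def by auto
    ultimately show "l (A \<union> B) = l A + l B"
      unfolding l_def using finite_measure_Union[OF N N] by simp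
  qed (simp add: l_def)
  moreover have "l (p -` B \<inter> \<Omega>) = prob B" if B: "B \<in> G" for B
    unfolding l_def
  proof (rule measure_eq_AE)
    show "AE x in M. x \<in> N (p -` B \<inter> \<Omega>) \<longleftrightarrow> x \<in> B"
      using ae AE_space
    proof eventually_elim
      fix x assume x: "x \<in> p ` \<Omega>" "x \<in> space M"
      then have "c x \<in> (\<lambda>y. c (p y)) ` \<Omega>" by auto
      then have "c (p (sel (c x))) = c x" using sel by simp
      then have "p (sel (c x)) \<in> B \<longleftrightarrow> x \<in> B" using B unfolding c_def by blast
      then show "x \<in> N (p -` B \<inter> \<Omega>) \<longleftrightarrow> x \<in> B" unfolding N_def using sel x by simp
    qed
  qed (use N B G(2) in auto)
  ultimately show ?thesis by blast
qed

text \<open>The contents that are correct on a given finite family of measurable sets form a nonempty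
  closed subset of the compact cube of set functions with values in the unit interval. By
  compactness some content is correct on all of them. No measurable selection is involved, at the
  price of losing countable additivity.\<close>

lemma (in prob_space) finitely_additive_lift:
  assumes p: "p \<in> \<Omega> \<rightarrow> space M" and ae: "AE x in M. x \<in> p ` \<Omega>"
  shows "\<exists>l. fin_add_prob \<Omega> l \<and> (\<forall>B\<in>sets M. l (p -` B \<inter> \<Omega>) = measure M B)"
proof -
  define P where "P = PiE UNIV (\<lambda>A::'b set. {0..1::real})"
  define h where "h B = {l :: 'b set \<Rightarrow> real. l (p -` B \<inter> \<Omega>) = prob B}" for B
  define ad where "ad = (\<lambda>(A, B). {l :: 'b set \<Rightarrow> real. l (A \<union> B) = l A + l B})"
  define I where "I = {(A, B). A \<subseteq> \<Omega> \<and> B \<subseteq> \<Omega> \<and> A \<inter> B = {}}"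
  define U where "U = insert {l. l \<Omega> = 1} (ad ` I) \<union> h ` events"
  have "compactin euclidean P"
    using compactin_PiE[of "\<lambda>_. euclidean :: real topology" UNIV "\<lambda>A::'b set. {0..1}"]
    by (simp add: euclidean_product_topology P_def)
  moreover have "closedin euclidean C" if C: "C \<in> U" for C
  proof -
    have co: "continuous_on UNIV (\<lambda>l :: 'b set \<Rightarrow> real. l A)" for A
      by (rule continuous_on_product_coordinates)
    have "closed {l :: 'b set \<Rightarrow> real. l A = r}" for A r
      by (rule closed_Collect_eq[OF co continuous_on_const])
    moreover have "closed {l :: 'b set \<Rightarrow> real. l A = l B + l C}" for A B C
      by (rule closed_Collect_eq[OF co continuous_on_add[OF co co]])
    ultimately have "closed C" using C unfolding U_def h_def ad_def by auto
    then show ?thesis by (simp add: closed_closedin[symmetric])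
  qed
  moreover have "P \<inter> \<Inter>F \<noteq> {}" if F: "finite F" "F \<subseteq> U" for F
  proof -
    have "finite (F \<inter> h ` events)" "F \<inter> h ` events \<subseteq> h ` events" using F by auto
    from finite_subset_image[OF this]
    obtain G where G: "G \<subseteq> events" "finite G" "F \<inter> h ` events = h ` G" by auto
    obtain l where l: "fin_add_prob \<Omega> l" "\<forall>B\<in>G. l (p -` B \<inter> \<Omega>) = prob B"
      using discrete_lift[OF p ae G(2,1)] by (elim exE conjE)
    \<comment> \<open>Points of the cube are defined on all sets, hence the truncation.\<close>
    define l' where "l' A = l (A \<inter> \<Omega>)" for A
    have "l' \<in> P"
      unfolding P_def l'_def using fin_add_prob_nonneg[OF l(1)] fin_add_prob_le_1[OF l(1)] by auto
    moreover have "l' \<in> X" if "X \<in> F" for X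
    proof (cases "X \<in> h ` events")
      case True
      then have "X \<in> h ` G" using G(3) that by blast
      then obtain B where B: "B \<in> G" "X = h B" by blast
      then show ?thesis using l(2) by (simp add: h_def l'_def Int_assoc)
    next
      case False
      then have "X = {l. l \<Omega> = 1} \<or> X \<in> ad ` I" using that F(2) unfolding U_def by blast
      then show ?thesis
      proof
        assume "X \<in> ad ` I"
        then obtain A B where AB: "X = {l. l (A \<union> B) = l A + l B}" "A \<subseteq> \<Omega>" "B \<subseteq> \<Omega>" "A \<inter> B = {}"
          unfolding ad_def I_def by auto
        then show ?thesis using fin_add_prob_Un[OF l(1) AB(2-4)]
          by (simp add: l'_def Int_absorb2)
      qed (use fin_add_prob_space[OF l(1)] in \<open>simp add: l'_def\<close>)
    qed
    ultimately show ?thesis by blast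
  qed
  ultimately have "P \<inter> \<Inter>U \<noteq> {}"
    using compactin_fip[of euclidean P] by (simp only:) simp
  then obtain l where l: "l \<in> P" "l \<in> \<Inter>U" by blast
  have lU: "l \<in> X" if "X \<in> U" for X using l(2) that by (rule InterD)
  have "0 \<le> l A" for A using l(1) unfolding P_def by (auto simp: PiE_iff)
  moreover have "l \<Omega> = 1" using lU[of "{l. l \<Omega> = 1}"] unfolding U_def by simp
  moreover have "l (A \<union> B) = l A + l B" if "A \<subseteq> \<Omega>" "B \<subseteq> \<Omega>" "A \<inter> B = {}" for A B
  proof -
    have "ad (A, B) \<in> U" unfolding U_def I_def using that by (intro UnI1 insertI2 imageI) simp
    from lU[OF this] show ?thesis by (simp add: ad_def)
  qed
  moreover have "l (p -` B \<inter> \<Omega>) = prob B" if "B \<in> events" for B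
  proof -
    have "h B \<in> U" unfolding U_def using that by simp
    from lU[OF this] show ?thesis by (simp add: h_def)
  qed
  ultimately show ?thesis unfolding fin_add_prob_def by (intro exI[of _ l]) simp
qed

text \<open>The mean of a bounded family of contents is a content, and left invariance of the mean
  becomes invariance of the average because applying \<open>S \<delta>\<close> and then \<open>S \<gamma>\<close>
  amounts to applying \<open>S (\<gamma> * \<delta>)\<close>. Values on which the whole family agrees are kept.\<close>

lemma amenable_average:
  fixes S :: "'g::semigroup_mult \<Rightarrow> 'a \<Rightarrow> 'a"
  assumes m: "left_invariant_mean m" and act: "semigroup_action \<Omega> S" and l: "fin_add_prob \<Omega> l"
  defines "L \<equiv> \<lambda>A. m (\<lambda>\<gamma>. l (S \<gamma> -` A \<inter> \<Omega>))"
  shows "fin_add_prob \<Omega> L"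
    and "A \<subseteq> \<Omega> \<Longrightarrow> L (S \<gamma> -` A \<inter> \<Omega>) = L A"
    and "(\<And>\<gamma>. l (S \<gamma> -` A \<inter> \<Omega>) = r) \<Longrightarrow> L A = r"
proof -
  have add: "\<And>f h. bounded (range f) \<Longrightarrow> bounded (range h) \<Longrightarrow> m (\<lambda>x. f x + h x) = m f + m h"
    and scale: "\<And>c f. bounded (range f) \<Longrightarrow> m (\<lambda>x. c * f x) = c * m f"
    and pos: "\<And>f. bounded (range f) \<Longrightarrow> (\<And>x. 0 \<le> f x) \<Longrightarrow> 0 \<le> m f"
    and one: "m (\<lambda>x. 1) = 1"
    and inv: "\<And>f g. bounded (range f) \<Longrightarrow> m (\<lambda>x. f (g * x)) = m f"
    using m unfolding left_invariant_mean_def by simp_all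
  have const: "m (\<lambda>x. r) = r" for r
    using scale[of "\<lambda>_. 1" r] one by simp
  have bdd: "bounded (range (\<lambda>\<gamma>. l (S \<gamma> -` A \<inter> \<Omega>)))" for A
    unfolding bounded_iff using fin_add_prob_nonneg[OF l] fin_add_prob_le_1[OF l]
    by (intro exI[of _ 1]) auto
  show "fin_add_prob \<Omega> L"
    unfolding fin_add_prob_def
  proof (intro conjI allI impI)
    show "0 \<le> L A" for A
      unfolding L_def by (intro pos bdd fin_add_prob_nonneg[OF l]) simp
    have "S \<gamma> -` \<Omega> \<inter> \<Omega> = \<Omega>" for \<gamma> using act unfolding semigroup_action_def by auto
    then show "L \<Omega> = 1" unfolding L_def by (simp add: fin_add_prob_space[OF l] const)
    fix A B :: "'a set" assume "A \<inter> B = {}"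
    then have "l (S \<gamma> -` (A \<union> B) \<inter> \<Omega>) = l (S \<gamma> -` A \<inter> \<Omega>) + l (S \<gamma> -` B \<inter> \<Omega>)" for \<gamma>
      unfolding vimage_Un Int_Un_distrib2 by (intro fin_add_prob_Un[OF l]) auto
    then show "L (A \<union> B) = L A + L B"
      unfolding L_def using add[OF bdd bdd] by simp
  qed
  show "L (S \<gamma> -` A \<inter> \<Omega>) = L A" if "A \<subseteq> \<Omega>"
  proof -
    have "S \<delta> -` (S \<gamma> -` A \<inter> \<Omega>) \<inter> \<Omega> = S (\<gamma> * \<delta>) -` A \<inter> \<Omega>" for \<delta>
      using act unfolding semigroup_action_def by auto
    then show ?thesis unfolding L_def using inv[OF bdd[of A], of \<gamma>] by simp
  qed
  show "L A = r" if "\<And>\<gamma>. l (S \<gamma> -` A \<inter> \<Omega>) = r"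
    unfolding L_def that by (rule const)
qed

section \<open>Countable additivity from compact fibres\<close>

lemma continuous_map_borel_of:
  assumes "continuous_map X Y f"
  shows "f \<in> borel_of X \<rightarrow>\<^sub>M borel_of Y"
  unfolding borel_of_def[of Y]
proof (rule measurable_measure_of)
  show "{U. openin Y U} \<subseteq> Pow (topspace Y)" by (auto dest: openin_subset)
  show "f \<in> space (borel_of X) \<rightarrow> topspace Y"
    using continuous_map_image_subset_topspace[OF assms] by auto
  fix U assume "U \<in> {U. openin Y U}"
  then have "openin X {x \<in> topspace X. f x \<in> U}" using assms by (simp add: continuous_map_def)
  moreover have "{x \<in> topspace X. f x \<in> U} = f -` U \<inter> space (borel_of X)" by auto
  ultimately show "f -` U \<inter> space (borel_of X) \<in> sets (borel_of X)"
    unfolding sets_borel_of by (intro sigma_sets.Basic) simp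
qed

text \<open>The preimage of a null set is null with respect to the completion, which has the same
  almost-everywhere statements.\<close>

lemma preserves_completed_AE:
  assumes T: "preserves_completed M T" and P: "AE x in M. P x"
  shows "AE x in M. P (T x)"
proof -
  from P have "\<exists>N\<in>null_sets M. {x \<in> space M. \<not> P x} \<subseteq> N"
    unfolding eventually_ae_filter .
  then obtain N where N: "N \<in> null_sets M" "{x \<in> space M. \<not> P x} \<subseteq> N" by (rule bexE)
  have Nm: "N \<in> sets M" and N0: "emeasure M N = 0" using N(1) by (simp_all add: null_sets_def)
  have Tm: "T \<in> completion M \<rightarrow>\<^sub>M M" using T unfolding preserves_completed_def by (rule conjunct1)
  have "emeasure (completion M) (T -` N \<inter> space M) = emeasure M N"
    using T Nm unfolding preserves_completed_def by simp
  then have "emeasure (completion M) (T -` N \<inter> space M) = 0" unfolding N0 .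
  moreover have "T -` N \<inter> space M \<in> sets (completion M)"
    using measurable_sets[OF Tm Nm] by simp
  ultimately have "T -` N \<inter> space M \<in> null_sets (completion M)" by (rule null_setsI)
  then have "AE x in completion M. x \<notin> T -` N \<inter> space M" by (rule AE_not_in)
  then have "AE x in completion M. P (T x)"
    using AE_space
  proof eventually_elim
    fix x assume x: "x \<notin> T -` N \<inter> space M" "x \<in> space (completion M)"
    then have "T x \<in> space M" using measurable_space[OF Tm] by simp
    with x N(2) show "P (T x)" by auto
  qed
  then show ?thesis by (simp add: AE_completion_iff)
qed

text \<open>The situation after averaging: a content on all subsets of \<open>Y\<close> that lifts
  \<open>\<mu>\<close>. The locale constructs a countably additive measure that agrees with the content
  on an algebra generating the Borel sets.\<close>

locale compact_fibred_content =
  fixes \<mu> :: "'x measure" and Y :: "'y topology" and p :: "'y \<Rightarrow> 'x" and l :: "'y set \<Rightarrow> real"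
  assumes std: "standard_borel \<mu>" and prob: "prob_space \<mu>" and polish: "polish_topology Y"
    and p: "p \<in> borel_of Y \<rightarrow>\<^sub>M \<mu>"
    and compact_fibres: "AE x in \<mu>. compactin Y {y \<in> topspace Y. p y = x}"
    and l: "fin_add_prob (topspace Y) l"
    and lift: "\<And>B. B \<in> sets \<mu> \<Longrightarrow> l (p -` B \<inter> topspace Y) = measure \<mu> B"
begin

abbreviation "\<Omega> \<equiv> topspace Y"

lemma Hausdorff_Y: "Hausdorff_space Y"
  using polish completely_metrizable_imp_metrizable_space metrizable_imp_Hausdorff_space
  by (auto simp: polish_topology_def)

lemma borel_sub: "A \<in> sets (borel_of Y) \<Longrightarrow> A \<subseteq> \<Omega>"
  using sets.sets_into_space by fastforce

lemma closed_borel: "closedin Y C \<Longrightarrow> C \<in> sets (borel_of Y)"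
proof -
  assume C: "closedin Y C"
  have "\<Omega> - C \<in> sets (borel_of Y)"
    unfolding sets_borel_of by (rule sigma_sets.Basic) (use C in auto)
  then have "space (borel_of Y) - (\<Omega> - C) \<in> sets (borel_of Y)" by (rule sets.compl_sets)
  moreover have "C \<subseteq> \<Omega>" using C by (rule closedin_subset)
  ultimately show ?thesis by (simp add: double_diff)
qed

text \<open>A substitute for compact sets. Compactness is required only inside almost every fibre, so
  the class contains all closed sets and all preimages of measurable sets of the base.\<close>

definition fibre_compact :: "'y set \<Rightarrow> bool" where
  "fibre_compact C \<longleftrightarrow> C \<in> sets (borel_of Y) \<and> (AE x in \<mu>. compactin Y (C \<inter> {y \<in> \<Omega>. p y = x}))"

lemma fibre_compact_borel: "fibre_compact C \<Longrightarrow> C \<in> sets (borel_of Y)"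
  and fibre_compact_AE: "fibre_compact C \<Longrightarrow> AE x in \<mu>. compactin Y (C \<inter> {y \<in> \<Omega>. p y = x})"
  unfolding fibre_compact_def by auto

lemma fibre_compact_closed: "closedin Y C \<Longrightarrow> fibre_compact C"
  unfolding fibre_compact_def using compact_fibres
  by (auto simp: closed_borel elim!: eventually_mono intro: closed_Int_compactin)

lemma fibre_compact_vimage:
  assumes B: "B \<in> sets \<mu>"
  shows "fibre_compact (p -` B \<inter> \<Omega>)"
  unfolding fibre_compact_def
proof
  show "p -` B \<inter> \<Omega> \<in> sets (borel_of Y)" using measurable_sets[OF p B] by simp
  show "AE x in \<mu>. compactin Y ((p -` B \<inter> \<Omega>) \<inter> {y \<in> \<Omega>. p y = x})"
    using compact_fibres
  proof eventually_elim
    fix x assume "compactin Y {y \<in> \<Omega>. p y = x}"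
    moreover have "(p -` B \<inter> \<Omega>) \<inter> {y \<in> \<Omega>. p y = x} = (if x \<in> B then {y \<in> \<Omega>. p y = x} else {})"
      by auto
    ultimately show "compactin Y ((p -` B \<inter> \<Omega>) \<inter> {y \<in> \<Omega>. p y = x})" by simp
  qed
qed

lemma fibre_compact_Un:
  assumes "fibre_compact A" "fibre_compact B"
  shows "fibre_compact (A \<union> B)"
  unfolding fibre_compact_def
proof
  show "AE x in \<mu>. compactin Y ((A \<union> B) \<inter> {y \<in> \<Omega>. p y = x})"
    using fibre_compact_AE[OF assms(1)] fibre_compact_AE[OF assms(2)]
    by eventually_elim (simp add: Int_Un_distrib2 compactin_Un)
qed (use assms fibre_compact_borel in auto)

lemma fibre_compact_Int:
  assumes "fibre_compact A" "fibre_compact B"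
  shows "fibre_compact (A \<inter> B)"
  unfolding fibre_compact_def
proof
  show "AE x in \<mu>. compactin Y ((A \<inter> B) \<inter> {y \<in> \<Omega>. p y = x})"
    using fibre_compact_AE[OF assms(1)] fibre_compact_AE[OF assms(2)]
  proof eventually_elim
    fix x assume "compactin Y (A \<inter> {y \<in> \<Omega>. p y = x})" "compactin Y (B \<inter> {y \<in> \<Omega>. p y = x})"
    then have "compactin Y ((A \<inter> {y \<in> \<Omega>. p y = x}) \<inter> (B \<inter> {y \<in> \<Omega>. p y = x}))"
      using Hausdorff_Y by (simp add: compactin_Int)
    moreover have "(A \<inter> {y \<in> \<Omega>. p y = x}) \<inter> (B \<inter> {y \<in> \<Omega>. p y = x}) = (A \<inter> B) \<inter> {y \<in> \<Omega>. p y = x}" by blast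
    ultimately show "compactin Y ((A \<inter> B) \<inter> {y \<in> \<Omega>. p y = x})" by simp
  qed
qed (use assms fibre_compact_borel in auto)

lemma fibre_compact_INT: "(\<And>i. i \<le> n \<Longrightarrow> fibre_compact (C i)) \<Longrightarrow> fibre_compact (\<Inter>i\<le>n::nat. C i)"
  by (induction n) (auto simp: atMost_Suc intro!: fibre_compact_Int)

text \<open>This is where compact fibres produce countable additivity. If the \<open>D n\<close> decrease
  to the empty set, they are empty from some stage on in every fibre that meets all of them in
  compact sets, so the images \<open>p ` D n\<close> decrease to a null set. These images are measurable for the
  completion, hence their measures tend to zero, and they dominate the content of \<open>D n\<close> because the
  content lifts \<open>\<mu>\<close>.\<close>

lemma continuous_at_empty:
  assumes D: "\<And>n. fibre_compact (D n)" and dec: "decseq D" and "(\<Inter>n. D n) = {}"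
  shows "(\<lambda>n. l (D n)) \<longlonglongrightarrow> 0"
proof -
  interpret prob_space \<mu> by (rule prob)
  interpret C: prob_space "completion \<mu>" by (rule prob_space_completion)
  have pD: "p ` D n \<in> sets (completion \<mu>)" for n
    by (rule borel_image_completion[OF std finite_measure_axioms polish p fibre_compact_borel[OF D]])
  have dec': "decseq (\<lambda>n. p ` D n)"
    using dec unfolding decseq_def by (blast intro: image_mono)
  have "(\<Inter>n. p ` D n) \<in> null_sets (completion \<mu>)"
  proof -
    have "AE x in \<mu>. \<forall>n. compactin Y (D n \<inter> {y \<in> \<Omega>. p y = x})"
      unfolding AE_all_countable using fibre_compact_AE[OF D] by blast
    then have "AE x in \<mu>. x \<notin> (\<Inter>n. p ` D n)"
    proof eventually_elim
      fix x assume x: "\<forall>n. compactin Y (D n \<inter> {y \<in> \<Omega>. p y = x})"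
      show "x \<notin> (\<Inter>n. p ` D n)"
      proof
        assume xp: "x \<in> (\<Inter>n. p ` D n)"
        have "(\<Inter>n. D n \<inter> {y \<in> \<Omega>. p y = x}) \<noteq> {}"
        proof (rule compactin_nest[of Y])
          show "closedin Y (D n \<inter> {y \<in> \<Omega>. p y = x})" for n
            using x Hausdorff_Y compactin_imp_closedin by blast
          show "D n \<inter> {y \<in> \<Omega>. p y = x} \<noteq> {}" for n
            using xp borel_sub[OF fibre_compact_borel[OF D[of n]]] by fastforce
          show "decseq (\<lambda>n. D n \<inter> {y \<in> \<Omega>. p y = x})"
            using dec unfolding decseq_def by blast
        qed (use x in simp)
        with assms(3) show False by auto
      qed
    qed
    then have "AE x in completion \<mu>. x \<notin> (\<Inter>n. p ` D n)" by (rule AE_completion)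
    moreover have "(\<Inter>n. p ` D n) \<in> sets (completion \<mu>)" using pD by auto
    ultimately show ?thesis by (simp add: AE_iff_null_sets)
  qed
  then have "measure (completion \<mu>) (\<Inter>n. p ` D n) = 0" by (rule measure_eq_0_null_sets)
  moreover have "(\<lambda>n. measure (completion \<mu>) (p ` D n)) \<longlonglongrightarrow> measure (completion \<mu>) (\<Inter>n. p ` D n)"
    by (rule C.finite_Lim_measure_decseq) (use pD dec' in auto)
  ultimately have lim: "(\<lambda>n. measure (completion \<mu>) (p ` D n)) \<longlonglongrightarrow> 0" by simp
  have DO: "D n \<subseteq> \<Omega>" for n by (rule borel_sub[OF fibre_compact_borel[OF D]])
  have "l (D n) \<le> measure (completion \<mu>) (p ` D n)" for n
  proof -
    from Complete_Measure.completion_upper[OF pD[of n]] obtain B where B: "B \<in> sets \<mu>" "p ` D n \<subseteq> B"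
      "emeasure (completion \<mu>) (p ` D n) = emeasure \<mu> B" by (elim bexE conjE)
    have "l (D n) \<le> l (p -` B \<inter> \<Omega>)"
      by (rule fin_add_prob_mono[OF l]) (use DO[of n] B(2) in auto)
    then show ?thesis using lift[OF B(1)] B(3) by (simp add: measure_def)
  qed
  moreover have "0 \<le> l (D n)" for n by (rule fin_add_prob_nonneg[OF l DO])
  ultimately show ?thesis by (intro tendsto_sandwich[OF _ _ tendsto_const lim]) auto
qed

definition inner_approx :: "'y set \<Rightarrow> bool" where
  "inner_approx A \<longleftrightarrow> (\<forall>e>0. \<exists>C. fibre_compact C \<and> C \<subseteq> A \<and> l (A - C) < e)"

lemma inner_approxE:
  assumes "inner_approx A" "0 < e"
  obtains C where "fibre_compact C" "C \<subseteq> A" "l (A - C) < e"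
  using assms unfolding inner_approx_def by blast

lemma inner_approx_fibre_compact: "fibre_compact C \<Longrightarrow> inner_approx C"
  unfolding inner_approx_def by (intro allI impI exI[of _ C]) (simp add: fin_add_prob_empty[OF l])

lemma inner_approx_op:
  assumes A: "A \<subseteq> \<Omega>" "inner_approx A" and B: "B \<subseteq> \<Omega>" "inner_approx B"
  shows "inner_approx (A \<inter> B)" "inner_approx (A \<union> B)"
proof -
  have *: "\<exists>C D. fibre_compact C \<and> C \<subseteq> A \<and> fibre_compact D \<and> D \<subseteq> B \<and> l ((A - C) \<union> (B - D)) < e" if "0 < e" for e
  proof -
    have e2: "0 < e / 2" using that by simp
    obtain C where C: "fibre_compact C" "C \<subseteq> A" "l (A - C) < e / 2" by (rule inner_approxE[OF A(2) e2])
    obtain D where D: "fibre_compact D" "D \<subseteq> B" "l (B - D) < e / 2" by (rule inner_approxE[OF B(2) e2])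
    have "l ((A - C) \<union> (B - D)) \<le> l (A - C) + l (B - D)"
      by (rule fin_add_prob_subadd[OF l]) (use A(1) B(1) in auto)
    with C D show ?thesis by (intro exI[of _ C] exI[of _ D]) auto
  qed
  show "inner_approx (A \<inter> B)"
    unfolding inner_approx_def
  proof (intro allI impI)
    fix e :: real assume "0 < e"
    from *[OF this] obtain C D where CD: "fibre_compact C" "C \<subseteq> A" "fibre_compact D" "D \<subseteq> B"
      "l ((A - C) \<union> (B - D)) < e" by blast
    have "l (A \<inter> B - C \<inter> D) \<le> l ((A - C) \<union> (B - D))"
      by (rule fin_add_prob_mono[OF l]) (use A(1) B(1) in auto)
    with CD show "\<exists>C. fibre_compact C \<and> C \<subseteq> A \<inter> B \<and> l (A \<inter> B - C) < e"
      by (intro exI[of _ "C \<inter> D"]) (auto intro: fibre_compact_Int)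
  qed
  show "inner_approx (A \<union> B)"
    unfolding inner_approx_def
  proof (intro allI impI)
    fix e :: real assume "0 < e"
    from *[OF this] obtain C D where CD: "fibre_compact C" "C \<subseteq> A" "fibre_compact D" "D \<subseteq> B"
      "l ((A - C) \<union> (B - D)) < e" by blast
    have "l (A \<union> B - (C \<union> D)) \<le> l ((A - C) \<union> (B - D))"
      by (rule fin_add_prob_mono[OF l]) (use A(1) B(1) in auto)
    with CD show "\<exists>C. fibre_compact C \<and> C \<subseteq> A \<union> B \<and> l (A \<union> B - C) < e"
      by (intro exI[of _ "C \<union> D"]) (auto intro: fibre_compact_Un)
  qed
qed

text \<open>The analogue of Jordan measurable sets: the content can be exhausted by fibre-compact sets
  both from inside and, passing to complements, from outside. On this algebra the content will turn
  out to be countably additive.\<close>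

definition jordan :: "'y set set" where
  "jordan = {A \<in> sets (borel_of Y). inner_approx A \<and> inner_approx (\<Omega> - A)}"

lemma jordan_sub: "A \<in> jordan \<Longrightarrow> A \<subseteq> \<Omega>"
  unfolding jordan_def using borel_sub by auto

lemma jordan_Compl: "A \<in> jordan \<Longrightarrow> \<Omega> - A \<in> jordan"
  using jordan_sub[of A] sets.compl_sets[of A "borel_of Y"] unfolding jordan_def by (auto simp: double_diff)

lemma jordan_Un: "A \<in> jordan \<Longrightarrow> B \<in> jordan \<Longrightarrow> A \<union> B \<in> jordan"
  using inner_approx_op(2)[of A B] inner_approx_op(1)[of "\<Omega> - A" "\<Omega> - B"] jordan_sub[of A] jordan_sub[of B]
  unfolding jordan_def by (auto simp: Diff_Un)

lemma jordan_vimage: "B \<in> sets \<mu> \<Longrightarrow> p -` B \<inter> \<Omega> \<in> jordan"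
proof -
  assume B: "B \<in> sets \<mu>"
  have "\<Omega> - (p -` B \<inter> \<Omega>) = p -` (space \<mu> - B) \<inter> \<Omega>"
    using measurable_space[OF p] by auto
  then show ?thesis
    unfolding jordan_def using B fibre_compact_vimage
    by (auto intro!: inner_approx_fibre_compact fibre_compact_borel[OF fibre_compact_vimage])
qed

lemma jordan_space: "\<Omega> \<in> jordan"
  using jordan_Compl[OF jordan_vimage[of "{}"]] by simp

lemma algebra_jordan: "algebra \<Omega> jordan"
proof (subst algebra_iff_Un, intro conjI ballI)
  show "jordan \<subseteq> Pow \<Omega>" using jordan_sub by blast
  show "{} \<in> jordan" using jordan_Compl[OF jordan_space] by simp
qed (auto intro: jordan_Compl jordan_Un)

text \<open>Shrink each set to a fibre-compact one with summable losses; finite intersections of the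
  shrunken sets are fibre-compact and still decrease to the empty set, so their contents tend to
  zero.\<close>

lemma jordan_continuous_at_empty:
  assumes A: "\<And>n. A n \<in> jordan" and dec: "decseq A" and emp: "(\<Inter>n. A n) = {}"
  shows "(\<lambda>n. l (A n)) \<longlonglongrightarrow> 0"
proof (rule LIMSEQ_I)
  fix e :: real assume e: "0 < e"
  have Asub: "A n \<subseteq> \<Omega>" for n by (rule jordan_sub[OF A])
  have "\<forall>n. \<exists>C. fibre_compact C \<and> C \<subseteq> A n \<and> l (A n - C) < e / 2 * (1 / 2) ^ Suc n"
  proof
    fix n
    have "inner_approx (A n)" "0 < e / 2 * (1 / 2) ^ Suc n" using A[of n] e by (simp_all add: jordan_def)
    then show "\<exists>C. fibre_compact C \<and> C \<subseteq> A n \<and> l (A n - C) < e / 2 * (1 / 2) ^ Suc n"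
      unfolding inner_approx_def by blast
  qed
  then obtain C where C: "\<forall>n. fibre_compact (C n) \<and> C n \<subseteq> A n \<and> l (A n - C n) < e / 2 * (1 / 2) ^ Suc n"
    by (rule exE[OF choice])
  define D where "D n = (\<Inter>i\<le>n. C i)" for n
  have "(\<lambda>n. l (D n)) \<longlonglongrightarrow> 0"
  proof (rule continuous_at_empty)
    show "fibre_compact (D n)" for n unfolding D_def using C by (intro fibre_compact_INT) simp
    show "decseq D" unfolding decseq_def D_def by auto
    have "D n \<subseteq> A n" for n unfolding D_def using C by blast
    with emp show "(\<Inter>n. D n) = {}" by blast
  qed
  with e obtain N where N: "\<And>n. n \<ge> N \<Longrightarrow> \<bar>l (D n)\<bar> < e / 2"
    unfolding LIMSEQ_def dist_real_def by (metis diff_zero half_gt_zero)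
  have "\<bar>l (A n)\<bar> < e" if "n \<ge> N" for n
  proof -
    have CO: "C i \<subseteq> \<Omega>" for i using C Asub by blast
    have DO: "D n \<subseteq> \<Omega>" unfolding D_def using CO by blast
    have "A n \<subseteq> D n \<union> (\<Union>i\<le>n. A i - C i)"
      unfolding D_def using decseqD[OF dec] by blast
    then have "l (A n) \<le> l (D n \<union> (\<Union>i\<le>n. A i - C i))"
      by (rule fin_add_prob_mono[OF l]) (use Asub DO in blast)
    also have "\<dots> \<le> l (D n) + l (\<Union>i\<le>n. A i - C i)"
      by (rule fin_add_prob_subadd[OF l]) (use Asub DO in blast)+
    also have "l (\<Union>i\<le>n. A i - C i) \<le> (\<Sum>i\<le>n. l (A i - C i))"
      by (rule fin_add_prob_subadd_UN[OF l]) (use Asub in auto)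
    also have "\<dots> \<le> (\<Sum>i\<le>n. e / 2 * (1 / 2) ^ Suc i)"
      using C by (intro sum_mono less_imp_le) simp
    also have "\<dots> = e / 2 * (1 - (1 / 2) ^ Suc n)"
      by (induction n) (simp_all add: field_simps)
    also have "\<dots> \<le> e / 2" using e by (simp add: field_simps)
    finally have "l (A n) \<le> l (D n) + e / 2" by simp
    moreover have "0 \<le> l (A n)" by (rule fin_add_prob_nonneg[OF l Asub])
    ultimately show ?thesis using N[OF that] by simp
  qed
  then show "\<exists>N. \<forall>n\<ge>N. norm (l (A n) - 0) < e" by auto
qed

text \<open>A closed ball is approximated from outside by concentric larger balls, whose contents
  converge to that of the given ball when its radius is a continuity point. The content being
  monotone in the radius, all but countably many radii qualify.\<close>

lemma jordan_sublevel:
  assumes d: "Metric_space \<Omega> d" "Metric_space.mtopology \<Omega> d = Y" and a: "a \<in> \<Omega>"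
    and cont: "isCont (\<lambda>t. l {y \<in> \<Omega>. d a y \<le> t}) t"
  shows "{y \<in> \<Omega>. d a y \<le> t} \<in> jordan"
proof -
  interpret Metric_space \<Omega> d by (rule d)
  have cl: "closedin Y {y \<in> \<Omega>. d a y \<le> s}" for s
  proof -
    have "{y \<in> \<Omega>. d a y \<le> s} = mcball a s" using a by auto
    then show ?thesis using closedin_mcball[of a s] d(2) by simp
  qed
  have "inner_approx (\<Omega> - {y \<in> \<Omega>. d a y \<le> t})"
    unfolding inner_approx_def
  proof (intro allI impI)
    fix e :: real assume "0 < e"
    then have "\<exists>\<delta>>0. \<forall>s. dist s t < \<delta> \<longrightarrow>
        dist (l {y \<in> \<Omega>. d a y \<le> s}) (l {y \<in> \<Omega>. d a y \<le> t}) < e"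
      using cont unfolding continuous_at_eps_delta by simp
    then obtain \<delta> where \<delta>: "0 < \<delta>" "\<forall>s. dist s t < \<delta> \<longrightarrow>
        dist (l {y \<in> \<Omega>. d a y \<le> s}) (l {y \<in> \<Omega>. d a y \<le> t}) < e" by (elim exE conjE)
    define s where "s = t + \<delta> / 2"
    have s: "t < s" "dist s t < \<delta>" using \<delta>(1) by (auto simp: s_def dist_real_def)
    define C where "C = {y \<in> \<Omega>. s \<le> d a y}"
    have "C = \<Omega> - mball a s" unfolding C_def using a by auto
    then have "closedin Y C" using openin_mball[of a s] d(2) by auto
    then have "fibre_compact C" by (rule fibre_compact_closed)
    moreover have "C \<subseteq> \<Omega> - {y \<in> \<Omega>. d a y \<le> t}" unfolding C_def using s by auto
    moreover have "l ((\<Omega> - {y \<in> \<Omega>. d a y \<le> t}) - C) < e"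
    proof -
      have "l ((\<Omega> - {y \<in> \<Omega>. d a y \<le> t}) - C) \<le> l ({y \<in> \<Omega>. d a y \<le> s} - {y \<in> \<Omega>. d a y \<le> t})"
        by (rule fin_add_prob_mono[OF l]) (auto simp: C_def)
      also have "\<dots> = l {y \<in> \<Omega>. d a y \<le> s} - l {y \<in> \<Omega>. d a y \<le> t}"
        by (rule fin_add_prob_Diff[OF l]) (use s in auto)
      finally show ?thesis using \<delta>(2)[rule_format, OF s(2)] by (simp add: dist_real_def)
    qed
    ultimately show "\<exists>C. fibre_compact C \<and> C \<subseteq> \<Omega> - {y \<in> \<Omega>. d a y \<le> t} \<and> l (\<Omega> - {y \<in> \<Omega>. d a y \<le> t} - C) < e"
      by blast
  qed
  then show ?thesis
    unfolding jordan_def using closed_borel[OF cl] inner_approx_fibre_compact[OF fibre_compact_closed[OF cl]]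
    by simp
qed

text \<open>For each centre in a dense sequence and each scale there is a ball of the algebra with
  radius between that scale and its double; these countably many balls generate the topology.\<close>

lemma sigma_sets_jordan: "sigma_sets \<Omega> jordan = sets (borel_of Y)"
proof
  have "sigma_sets (space (borel_of Y)) jordan \<subseteq> sets (borel_of Y)"
    by (rule sets.sigma_sets_subset) (auto simp: jordan_def)
  then show "sigma_sets \<Omega> jordan \<subseteq> sets (borel_of Y)" by simp
  have "\<Omega> \<noteq> {}" using fin_add_prob_space[OF l] fin_add_prob_empty[OF l] by force
  then obtain d a where d: "Metric_space \<Omega> d" "Metric_space.mcomplete \<Omega> d"
    and mt: "Metric_space.mtopology \<Omega> d = Y"
    and a: "\<forall>j::nat. a j \<in> \<Omega>" and dense: "\<forall>y\<in>\<Omega>. \<forall>e>0. \<exists>j. d (a j) y < e"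
    by (rule polish_metricE[OF polish])
  interpret Metric_space \<Omega> d by (rule d)
  have good: "\<exists>t. \<epsilon> < t \<and> t < 2 * \<epsilon> \<and> {y \<in> \<Omega>. d (a j) y \<le> t} \<in> jordan" if \<epsilon>: "0 < \<epsilon>" for \<epsilon> :: real and j
  proof -
    let ?G = "\<lambda>t. l {y \<in> \<Omega>. d (a j) y \<le> t}"
    have "mono ?G" unfolding mono_def by (intro allI impI fin_add_prob_mono[OF l]) auto
    then have "countable {t. \<not> isCont ?G t}" by (rule mono_ctble_discont)
    moreover have "uncountable {\<epsilon><..<2 * \<epsilon>}" using \<epsilon> by (simp add: uncountable_open_interval)
    ultimately have "\<not> {\<epsilon><..<2 * \<epsilon>} \<subseteq> {t. \<not> isCont ?G t}" using countable_subset by blast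
    then obtain t where t: "\<epsilon> < t" "t < 2 * \<epsilon>" "isCont ?G t" by auto
    have "{y \<in> \<Omega>. d (a j) y \<le> t} \<in> jordan"
      by (rule jordan_sublevel[OF d(1) mt a[rule_format] t(3)])
    with t(1,2) show ?thesis by blast
  qed
  have "\<forall>j n. \<exists>t. 1 / real (Suc n) < t \<and> t < 2 * (1 / real (Suc n)) \<and> {y \<in> \<Omega>. d (a j) y \<le> t} \<in> jordan"
    by (intro allI good) simp
  then have "\<exists>t. \<forall>j n. 1 / real (Suc n) < t j n \<and> t j n < 2 * (1 / real (Suc n)) \<and> {y \<in> \<Omega>. d (a j) y \<le> t j n} \<in> jordan"
    by (simp only: choice_iff)
  then obtain t where t: "\<forall>j n. 1 / real (Suc n) < t j n \<and> t j n < 2 * (1 / real (Suc n)) \<and>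
      {y \<in> \<Omega>. d (a j) y \<le> t j n} \<in> jordan" by (rule exE)
  have "U \<in> sigma_sets \<Omega> jordan" if U: "openin Y U" for U
  proof -
    define V where "V = (\<lambda>(j, n). {y \<in> \<Omega>. d (a j) y \<le> t j n})"
    define I where "I = {i. V i \<subseteq> U}"
    have "(\<Union>i\<in>I. V i) \<in> sigma_sets \<Omega> jordan"
    proof (rule sigma_sets_UNION)
      show "countable (V ` I)" by blast
      show "\<And>B. B \<in> V ` I \<Longrightarrow> B \<in> sigma_sets \<Omega> jordan"
        using t by (auto simp: V_def intro: sigma_sets.Basic)
    qed
    moreover have "(\<Union>i\<in>I. V i) = U"
    proof (intro equalityI subsetI)
      fix y assume y: "y \<in> U"
      have "openin mtopology U" using U mt by simp
      then obtain r where r: "0 < r" "mball y r \<subseteq> U" and yO: "y \<in> \<Omega>"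
        using y unfolding openin_mtopology by blast
      obtain n where n: "1 / real (Suc n) < r / 3" using nat_approx_posE[of "r / 3"] r(1) by auto
      obtain j where j: "d (a j) y < 1 / real (Suc n)" using dense[rule_format, OF yO, of "1 / real (Suc n)"] by auto
      have "V (j, n) \<subseteq> mball y r"
      proof
        fix z assume "z \<in> V (j, n)"
        then have z: "z \<in> \<Omega>" "d (a j) z \<le> t j n" by (auto simp: V_def)
        have "d y z \<le> d (a j) y + d (a j) z"
          using triangle[of y "a j" z] a yO z(1) by (simp add: commute)
        also have "\<dots> < r" using j z(2) t[rule_format, of n j] n by linarith
        finally show "z \<in> mball y r" using yO z(1) by simp
      qed
      then have "(j, n) \<in> I" using r(2) unfolding I_def by blast
      moreover have "y \<in> V (j, n)" unfolding V_def using yO j t[rule_format, of n j] by auto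
      ultimately show "y \<in> (\<Union>i\<in>I. V i)" by blast
    qed (auto simp: I_def)
    ultimately show ?thesis by simp
  qed
  then have "sigma_sets \<Omega> {U. openin Y U} \<subseteq> sigma_sets \<Omega> jordan"
    by (intro sigma_sets_mono) auto
  then show "sets (borel_of Y) \<subseteq> sigma_sets \<Omega> jordan" by (simp add: sets_borel_of)
qed

lemma measure_extension:
  obtains \<nu> where "sets \<nu> = sets (borel_of Y)" "\<forall>A\<in>jordan. emeasure \<nu> A = ennreal (l A)"
proof -
  interpret algebra \<Omega> jordan by (rule algebra_jordan)
  let ?f = "\<lambda>A. ennreal (l A)"
  have "\<exists>\<nu>. (\<forall>A\<in>jordan. \<nu> A = ?f A) \<and> measure_space \<Omega> (sigma_sets \<Omega> jordan) \<nu>"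
  proof (rule caratheodory_empty_continuous)
    show "positive jordan ?f" by (simp add: positive_def fin_add_prob_empty[OF l])
    show "additive jordan ?f"
      unfolding additive_def using jordan_sub fin_add_prob_Un[OF l] fin_add_prob_nonneg[OF l]
      by (simp add: ennreal_plus)
    show "(\<lambda>n. ?f (A n)) \<longlonglongrightarrow> 0" if "range A \<subseteq> jordan" "decseq A" "(\<Inter>n. A n) = {}" for A
      using tendsto_ennrealI[OF jordan_continuous_at_empty[of A]] that by auto
  qed simp
  then obtain \<nu> where \<nu>: "\<forall>A\<in>jordan. \<nu> A = ?f A" "measure_space \<Omega> (sigma_sets \<Omega> jordan) \<nu>" by blast
  define N where "N = measure_of \<Omega> jordan \<nu>"
  have setsN: "sets N = sigma_sets \<Omega> jordan"
    unfolding N_def using jordan_sub by (intro sets_measure_of) blast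
  then have "sets N = sets (borel_of Y)" by (simp only: sigma_sets_jordan)
  moreover have "emeasure N A = ?f A" if "A \<in> jordan" for A
  proof -
    have "emeasure N A = \<nu> A"
      using \<nu>(2) that jordan_sub unfolding measure_space_def
      by (intro emeasure_measure_of[OF N_def]) (auto simp: setsN)
    with \<nu>(1) that show ?thesis by simp
  qed
  ultimately show thesis by (intro that[of N]) auto
qed

text \<open>A continuous map over \<open>T\<close> sends the fibre over \<open>x\<close> into the fibre over
  \<open>T x\<close>, so it pulls fibre-compact sets back to fibre-compact sets; the exceptional
  fibres stay negligible since preimages of null sets under \<open>T\<close> are null. Invariance of the content
  does the rest.\<close>

lemma jordan_invariant:
  assumes S: "continuous_map Y Y S" and T: "preserves_completed \<mu> T"
    and eq: "\<And>y. y \<in> \<Omega> \<Longrightarrow> p (S y) = T (p y)"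
    and inv: "\<And>A. A \<subseteq> \<Omega> \<Longrightarrow> l (S -` A \<inter> \<Omega>) = l A"
    and A: "A \<in> jordan"
  shows "S -` A \<inter> \<Omega> \<in> jordan"
proof -
  have SO: "S y \<in> \<Omega>" if "y \<in> \<Omega>" for y using continuous_map_image_subset_topspace[OF S] that by auto
  have Sm: "S \<in> borel_of Y \<rightarrow>\<^sub>M borel_of Y"
    by (rule continuous_map_borel_of[OF S])
  have fc: "fibre_compact (S -` C \<inter> \<Omega>)" if C: "fibre_compact C" for C
    unfolding fibre_compact_def
  proof
    show "S -` C \<inter> \<Omega> \<in> sets (borel_of Y)"
      using measurable_sets[OF Sm fibre_compact_borel[OF C]] by simp
    have "AE x in \<mu>. compactin Y (C \<inter> {y \<in> \<Omega>. p y = T x})"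
      by (rule preserves_completed_AE[OF T fibre_compact_AE[OF C]])
    with compact_fibres show "AE x in \<mu>. compactin Y ((S -` C \<inter> \<Omega>) \<inter> {y \<in> \<Omega>. p y = x})"
    proof eventually_elim
      fix x assume 1: "compactin Y {y \<in> \<Omega>. p y = x}" and 2: "compactin Y (C \<inter> {y \<in> \<Omega>. p y = T x})"
      have "closedin Y {y \<in> \<Omega>. S y \<in> C \<inter> {y \<in> \<Omega>. p y = T x}}"
        by (rule closedin_continuous_map_preimage[OF S compactin_imp_closedin[OF Hausdorff_Y 2]])
      then have "compactin Y ({y \<in> \<Omega>. S y \<in> C \<inter> {y \<in> \<Omega>. p y = T x}} \<inter> {y \<in> \<Omega>. p y = x})"
        using 1 by (rule closed_Int_compactin)
      moreover have "{y \<in> \<Omega>. S y \<in> C \<inter> {y \<in> \<Omega>. p y = T x}} \<inter> {y \<in> \<Omega>. p y = x}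
          = (S -` C \<inter> \<Omega>) \<inter> {y \<in> \<Omega>. p y = x}"
        using SO eq by auto
      ultimately show "compactin Y ((S -` C \<inter> \<Omega>) \<inter> {y \<in> \<Omega>. p y = x})" by simp
    qed
  qed
  have ia: "inner_approx (S -` B \<inter> \<Omega>)" if B: "B \<subseteq> \<Omega>" "inner_approx B" for B
    unfolding inner_approx_def
  proof (intro allI impI)
    fix e :: real assume "0 < e"
    then obtain C where C: "fibre_compact C" "C \<subseteq> B" "l (B - C) < e" by (rule inner_approxE[OF B(2)])
    have "l (S -` (B - C) \<inter> \<Omega>) = l (B - C)" by (rule inv) (use B(1) in auto)
    moreover have "S -` B \<inter> \<Omega> - (S -` C \<inter> \<Omega>) = S -` (B - C) \<inter> \<Omega>" by auto
    ultimately show "\<exists>C. fibre_compact C \<and> C \<subseteq> S -` B \<inter> \<Omega> \<and> l (S -` B \<inter> \<Omega> - C) < e"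
      using C fc[OF C(1)] by (intro exI[of _ "S -` C \<inter> \<Omega>"]) auto
  qed
  have "\<Omega> - (S -` A \<inter> \<Omega>) = S -` (\<Omega> - A) \<inter> \<Omega>" using SO by auto
  moreover have "S -` A \<inter> \<Omega> \<in> sets (borel_of Y)"
    using measurable_sets[OF Sm, of A] A by (simp add: jordan_def)
  ultimately show ?thesis
    using A ia[of A] ia[of "\<Omega> - A"] jordan_sub[OF A] by (simp add: jordan_def)
qed

lemma jordan_Int: "A \<in> jordan \<Longrightarrow> B \<in> jordan \<Longrightarrow> A \<inter> B \<in> jordan"
  using algebra.axioms(1)[OF algebra_jordan] ring_of_sets.axioms(1) semiring_of_sets.Int by metis

end

section \<open>The invariant lift\<close>

theorem theorem2:
  fixes \<mu> :: "'x measure"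
    and Y :: "'y topology"
    and p :: "'y \<Rightarrow> 'x"
    and S :: "'g::semigroup_mult \<Rightarrow> 'y \<Rightarrow> 'y"
    and T :: "'g \<Rightarrow> 'x \<Rightarrow> 'x"
  assumes "standard_borel \<mu>" and "prob_space \<mu>"
    and "polish_topology Y"
    and "p \<in> borel_of Y \<rightarrow>\<^sub>M \<mu>"
    and "emeasure (completion \<mu>) (p ` topspace Y) = 1"
    and "AE x in \<mu>. compactin Y {y \<in> topspace Y. p y = x}"
    and "left_amenable TYPE('g)"
    and "semigroup_action (topspace Y) S"
    and "semigroup_action (space \<mu>) T"
    and "\<And>\<gamma>. continuous_map Y Y (S \<gamma>)"
    and "\<And>\<gamma>. preserves_completed \<mu> (T \<gamma>)"
    and "\<And>\<gamma> y. y \<in> topspace Y \<Longrightarrow> p (S \<gamma> y) = T \<gamma> (p y)"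
  shows "\<exists>\<nu> :: 'y measure. sets \<nu> = sets (borel_of Y) \<and> prob_space \<nu> \<and>
           (\<forall>\<gamma>. distr \<nu> (borel_of Y) (S \<gamma>) = \<nu>) \<and> distr \<nu> \<mu> p = \<mu>"
proof -
  let ?C = "completion \<mu>"
  let ?Y = "topspace Y"
  interpret prob_space \<mu> by fact
  interpret C: prob_space ?C by (rule prob_space_completion)
  have pY: "p y \<in> space \<mu>" if "y \<in> ?Y" for y
    using measurable_space[OF assms(4)] that by simp
  have SY: "S \<gamma> y \<in> ?Y" if "y \<in> ?Y" for \<gamma> y
    using assms(8) that unfolding semigroup_action_def by simp
  have "p ` ?Y \<in> sets ?C"
    using assms(5) emeasure_notin_sets by fastforce
  then have "AE x in ?C. x \<in> p ` ?Y"
    using assms(5) by (simp add: C.emeasure_eq_measure C.prob_eq_1)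
  then obtain l0 where l0: "fin_add_prob ?Y l0" "\<forall>B\<in>sets ?C. l0 (p -` B \<inter> ?Y) = measure ?C B"
    using C.finitely_additive_lift[of p ?Y] pY by auto
  obtain m :: "('g \<Rightarrow> real) \<Rightarrow> real" where m: "left_invariant_mean m"
    using assms(7) unfolding left_amenable_def by blast
  define l where "l A = m (\<lambda>\<gamma>. l0 (S \<gamma> -` A \<inter> ?Y))" for A
  note average = amenable_average[OF m assms(8) l0(1), folded l_def]
  \<comment> \<open>Each term of the average still lifts \<open>\<mu>\<close>, because \<open>S \<gamma>\<close> covers the measure
    preserving map \<open>T \<gamma>\<close>. The preimage of \<open>B\<close> under \<open>T \<gamma>\<close> is measurable for the
    completion only, which is why \<open>l0\<close> lifts the completed measure.\<close>
  have lift: "l (p -` B \<inter> ?Y) = measure \<mu> B" if B: "B \<in> sets \<mu>" for B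
  proof (rule average(3))
    fix \<gamma>
    have T: "T \<gamma> \<in> ?C \<rightarrow>\<^sub>M \<mu>" and TB: "emeasure ?C (T \<gamma> -` B \<inter> space \<mu>) = emeasure \<mu> B"
      using assms(11)[of \<gamma>] B unfolding preserves_completed_def by simp_all
    have "S \<gamma> -` (p -` B \<inter> ?Y) \<inter> ?Y = p -` (T \<gamma> -` B \<inter> space \<mu>) \<inter> ?Y"
      using assms(12)[of _ \<gamma>] pY SY by auto
    moreover have "l0 (p -` (T \<gamma> -` B \<inter> space \<mu>) \<inter> ?Y) = measure ?C (T \<gamma> -` B \<inter> space \<mu>)"
      by (rule l0(2)[rule_format]) (use measurable_sets[OF T B] in simp)
    moreover have "measure ?C (T \<gamma> -` B \<inter> space \<mu>) = measure \<mu> B"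
      unfolding measure_def TB ..
    ultimately show "l0 (S \<gamma> -` (p -` B \<inter> ?Y) \<inter> ?Y) = measure \<mu> B" by (simp only:)
  qed
  interpret F: compact_fibred_content \<mu> Y p l
    by unfold_locales (use assms(1-4,6) average(1) lift in auto)
  obtain \<nu> where \<nu>: "sets \<nu> = sets (borel_of Y)" "\<forall>A\<in>F.jordan. emeasure \<nu> A = ennreal (l A)"
    by (rule F.measure_extension)
  have sp: "space \<nu> = ?Y" using sets_eq_imp_space_eq[OF \<nu>(1)] by simp
  have pm: "p \<in> \<nu> \<rightarrow>\<^sub>M \<mu>" using assms(4) \<nu>(1) measurable_cong_sets by blast
  have "prob_space \<nu>"
    by (rule prob_spaceI) (use \<nu>(2) F.jordan_space sp fin_add_prob_space[OF average(1)] in simp)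
  moreover have "distr \<nu> \<mu> p = \<mu>"
  proof (rule measure_eqI)
    fix B assume "B \<in> sets (distr \<nu> \<mu> p)"
    then have B: "B \<in> sets \<mu>" by simp
    have "emeasure (distr \<nu> \<mu> p) B = emeasure \<nu> (p -` B \<inter> ?Y)"
      using emeasure_distr[OF pm B] sp by simp
    also have "\<dots> = ennreal (l (p -` B \<inter> ?Y))" using \<nu>(2) F.jordan_vimage[OF B] by simp
    also have "\<dots> = emeasure \<mu> B" using lift[OF B] by (simp add: emeasure_eq_measure)
    finally show "emeasure (distr \<nu> \<mu> p) B = emeasure \<mu> B" .
  qed simp
  moreover have "distr \<nu> (borel_of Y) (S \<gamma>) = \<nu>" for \<gamma>
  proof -
    have Sm: "S \<gamma> \<in> \<nu> \<rightarrow>\<^sub>M borel_of Y"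
      using continuous_map_borel_of[OF assms(10)] \<nu>(1) measurable_cong_sets by blast
    have em: "emeasure (distr \<nu> (borel_of Y) (S \<gamma>)) A = ennreal (l A)" if A: "A \<in> F.jordan" for A
    proof -
      have "emeasure (distr \<nu> (borel_of Y) (S \<gamma>)) A = emeasure \<nu> (S \<gamma> -` A \<inter> ?Y)"
        using A emeasure_distr[OF Sm, of A] sp by (simp add: F.jordan_def)
      also have "\<dots> = ennreal (l (S \<gamma> -` A \<inter> ?Y))"
        using \<nu>(2) F.jordan_invariant[OF assms(10) assms(11) assms(12) average(2) A] by simp
      finally show ?thesis using average(2)[OF F.jordan_sub[OF A]] by simp
    qed
    show ?thesis
    proof (rule measure_eqI_generator_eq[where E = F.jordan and \<Omega> = ?Y and A = "\<lambda>_. ?Y"])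
      show "Int_stable F.jordan" unfolding Int_stable_def using F.jordan_Int by blast
      show "F.jordan \<subseteq> Pow ?Y" using F.jordan_sub by blast
      show "emeasure (distr \<nu> (borel_of Y) (S \<gamma>)) A = emeasure \<nu> A" if "A \<in> F.jordan" for A
        using em[OF that] \<nu>(2) that by simp
      show "sets (distr \<nu> (borel_of Y) (S \<gamma>)) = sigma_sets ?Y F.jordan"
        by (simp add: F.sigma_sets_jordan)
      show "sets \<nu> = sigma_sets ?Y F.jordan" by (simp add: F.sigma_sets_jordan \<nu>(1))
      show "emeasure (distr \<nu> (borel_of Y) (S \<gamma>)) ?Y \<noteq> \<infinity>" using em[OF F.jordan_space] by simp
    qed (use F.jordan_space in auto)
  qed
  ultimately show ?thesis using \<nu>(1) by (intro exI[of _ \<nu>]) simp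
qed

end
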